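(* Let $0<\sigma<\infty$ and let $f\in B^1_\sigma$ with $\|f\|_{L^1(\mathbb{R})}=1$ and $\sigma_f=\sigma$. Suppose $f$ has no conjugate zeros and all real zeros of $f$ are simple. If there exist $\tau$ with $0<\tau\le 3$ and $y_0\in\mathbb{R}$ such that \[ \inf_{x\in\mathbb{R}}\bigl(|x+iy_0|^{\tau}\,|f(x+iy_0)|\bigr)>0, \] then $f$ is an exposed point of the closed unit ball $D(B^1_\sigma)$.
   Context: For $0<\sigma<\infty$, the Bernstein space $B^1_\sigma$ is the space of $f\in L^1(\mathbb{R})$ whose Fourier transform is supported in $[-\sigma,\sigma]$, with the $L^1(\mathbb{R})$ norm; by the Paley–Wiener theorem each such $f$ extends to an entire function of exponential type at most $\sigma$, and $f$ is identified with this extension. $D(B^1_\sigma)$ denotes its closed unit ball. For an entire function $f$ of exponential type, $\sigma_f$ denotes its type, i.e. the infimum of $a\ge0$ such that for every $\varepsilon>0$ there is $M_\varepsilon$ with $|f(z)|\le M_\varepsilon e^{(a+\varepsilon)|z|}$ for all $z\in\mathbb{C}$. A real zero of $f$ is a zero lying in $\mathbb{R}$; a conjugate zero of $f$ is a point $\lambda\in\mathbb{C}\setminus\mathbb{R}$ with $f(\lambda)=f(\bar\lambda)=0$. A point $f\in D(B^1_\sigma)$ is exposed if there is a continuous linear functional $\Phi$ on $B^1_\sigma$ with $\Phi(f)=\|\Phi\|=1$ and $\mathrm{Re}\,\Phi(g)<1$ for all $g\in D(B^1_\sigma)$, $g\ne f$. *)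

theory Defs
  imports "HOL-Analysis.Analysis"
begin

definition fourier_real :: "(complex \<Rightarrow> complex) \<Rightarrow> real \<Rightarrow> complex" where
  "fourier_real F \<xi> = (LINT x|lborel. F (of_real x) * cis (- (\<xi> * x)))"

definition L1norm :: "(complex \<Rightarrow> complex) \<Rightarrow> real" where
  "L1norm F = (LINT x|lborel. cmod (F (of_real x)))"

text \<open>Bernstein space B^1_sigma: entire functions whose restriction to R is in L1 and
  whose Fourier transform vanishes outside [-sigma, sigma] (each L1 function with such
  Fourier transform is identified with its entire extension).\<close>
definition Bernstein1 :: "real \<Rightarrow> (complex \<Rightarrow> complex) set" where
  "Bernstein1 \<sigma> = {F. F holomorphic_on UNIV \<and>
      integrable lborel (\<lambda>x::real. F (of_real x)) \<and>
      (\<forall>\<xi>. \<bar>\<xi>\<bar> > \<sigma> \<longrightarrow> fourier_real F \<xi> = 0)}"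

definition Bernstein1_ball :: "real \<Rightarrow> (complex \<Rightarrow> complex) set" where
  "Bernstein1_ball \<sigma> = {F \<in> Bernstein1 \<sigma>. L1norm F \<le> 1}"

definition exp_type :: "(complex \<Rightarrow> complex) \<Rightarrow> real" where
  "exp_type F = Inf {a. a \<ge> 0 \<and> (\<forall>\<epsilon>>0. \<exists>M. \<forall>z. cmod (F z) \<le> M * exp ((a + \<epsilon>) * cmod z))}"

definition real_zeros_simple :: "(complex \<Rightarrow> complex) \<Rightarrow> bool" where
  "real_zeros_simple F \<longleftrightarrow> (\<forall>x::real. F (of_real x) = 0 \<longrightarrow> deriv F (of_real x) \<noteq> 0)"

definition no_conjugate_zeros :: "(complex \<Rightarrow> complex) \<Rightarrow> bool" where
  "no_conjugate_zeros F \<longleftrightarrow> \<not> (\<exists>w. Im w \<noteq> 0 \<and> F w = 0 \<and> F (cnj w) = 0)"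

definition cont_linear_functional :: "real \<Rightarrow> ((complex \<Rightarrow> complex) \<Rightarrow> complex) \<Rightarrow> bool" where
  "cont_linear_functional \<sigma> \<Phi> \<longleftrightarrow>
     (\<forall>g\<in>Bernstein1 \<sigma>. \<forall>h\<in>Bernstein1 \<sigma>. \<forall>a b::complex.
         \<Phi> (\<lambda>z. a * g z + b * h z) = a * \<Phi> g + b * \<Phi> h) \<and>
     (\<forall>g\<in>Bernstein1 \<sigma>. \<forall>\<epsilon>>0. \<exists>\<delta>>0. \<forall>h\<in>Bernstein1 \<sigma>.
         L1norm (\<lambda>z. h z - g z) < \<delta> \<longrightarrow> cmod (\<Phi> h - \<Phi> g) < \<epsilon>)"

definition functional_norm :: "real \<Rightarrow> ((complex \<Rightarrow> complex) \<Rightarrow> complex) \<Rightarrow> real" where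
  "functional_norm \<sigma> \<Phi> = Sup ((\<lambda>g. cmod (\<Phi> g)) ` Bernstein1_ball \<sigma>)"

definition exposed_point :: "real \<Rightarrow> (complex \<Rightarrow> complex) \<Rightarrow> bool" where
  "exposed_point \<sigma> f \<longleftrightarrow> f \<in> Bernstein1_ball \<sigma> \<and>
     (\<exists>\<Phi>. cont_linear_functional \<sigma> \<Phi> \<and> \<Phi> f = 1 \<and> functional_norm \<sigma> \<Phi> = 1 \<and>
        (\<forall>g\<in>Bernstein1_ball \<sigma>. g \<noteq> f \<longrightarrow> Re (\<Phi> g) < 1))"

end

theory Submission
  imports Defs "HOL-Complex_Analysis.Complex_Analysis" "HOL-Probability.Probability"
begin

text \<open>The functional \<open>\<Phi>(g) = \<integral> g \<cdot> cnj (sgn f)\<close> exposes \<open>f\<close>. If \<open>g\<close> lies in the unit ball and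
  \<open>Re \<Phi>(g) \<ge> 1\<close>, then \<open>h = g / f \<ge> 0\<close> on the real line; the hypotheses on the zeros of \<open>f\<close> make \<open>h\<close>
  entire, and \<open>h\<close> is symmetric under conjugation. By the lower bound for \<open>f\<close>, \<open>h\<close> has cubic growth on
  the lines \<open>Im z = \<plusminus>y0\<close>. As \<open>f\<close> has exact type \<open>\<sigma>\<close>, it does so in one of the half-planes, say the
  upper one, where then \<open>exp(\<i>\<sigma>z) f(z)\<close> does not decay exponentially. There the quotient \<open>h\<close> of two
  bounded functions inherits the cubic bound from the boundary: after dividing out zeros by Blaschke
  factors the denominator is \<open>exp(-q)\<close> with \<open>Re q \<ge> 0\<close>, Harnack's inequality turns smallness of
  \<open>Re q\<close> at one point into \<open>Re q \<le> C \<epsilon> R\<^sup>2 / Im z\<close> on a box of size \<open>R\<close>, and barriers improve this to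
  \<open>ln |h| \<le> C \<epsilon> Im z\<close> up to the boundary contribution. Hence \<open>h\<close> is a polynomial. Degree at least 2 would
  force \<open>|g(x + \<i>y0)| \<ge> c / |x|\<close>, which is not integrable; degree 1 is excluded by positivity. So \<open>h\<close>
  is constant.\<close>

section \<open>Quotients of bounded functions in a half-plane\<close>

text \<open>The obstacle is that \<open>f\<close> may have infinitely many zeros in the half-plane,
  while its exact type supplies, for each \<epsilon>, just one point \<open>z1\<close> where it is
  not too small. Near the zeros of \<open>f\<close> nothing bounds \<open>h\<close> a priori, so
  Phragmen-Lindelof cannot be applied to \<open>h\<close> at once. The normalised quotient
  \<open>k\<close> is therefore handled only through bounds on \<open>k * F\<close> in the
  half-plane and on \<open>k\<close> on the boundary: zeros of \<open>F\<close> can then be divided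
  out without touching \<open>k\<close>, finitely many for each radius \<open>R\<close>. First
  \<open>R\<close> tends to infinity with \<epsilon> and \<open>z1\<close> fixed, then \<epsilon>
  tends to 0. The half-plane in question is Im z > -|y0|. Its boundary is a line on which
  \<open>h\<close> is controlled, and together with its mirror image it covers the plane. The bound
  3 for \<tau> is the threshold for degree 2: |x|^(2 - \<tau>) fails to be integrable at infinity
  exactly when \<tau> \<le> 3. Degree 1 would only give |x|^(1 - \<tau>), which may be integrable,
  hence the separate appeal to positivity.\<close>

lemma half_disc_maximum_modulus:
  assumes hol: "f holomorphic_on {z. Im z > 0}" and cont: "continuous_on {z. Im z \<ge> 0} f"
    and real: "\<And>z. Im z = 0 \<Longrightarrow> norm z \<le> \<rho> \<Longrightarrow> norm (f z) \<le> B"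
    and circle: "\<And>z. Im z \<ge> 0 \<Longrightarrow> norm z = \<rho> \<Longrightarrow> norm (f z) \<le> B"
    and z: "Im z \<ge> 0" "norm z \<le> \<rho>"
  shows "norm (f z) \<le> B"
proof -
  define S where "S = cball 0 \<rho> \<inter> {z. Im z \<ge> 0}"
  have cl: "closed S" unfolding S_def by (intro closed_Int closed_cball closed_halfspace_Im_ge)
  have int: "interior S = ball 0 \<rho> \<inter> {z. Im z > 0}"
  proof -
    have "{z. Im z \<ge> 0} = {z. inner \<i> z \<ge> 0}" "{z. Im z > 0} = {z. inner \<i> z > 0}"
      by (auto simp: inner_complex_def)
    thus ?thesis using interior_halfspace_ge[of \<i> 0] by (simp add: S_def)
  qed
  show ?thesis
  proof (rule maximum_modulus_frontier[where S = S and f = f])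
    show "f holomorphic_on interior S" using hol int by (auto intro: holomorphic_on_subset)
    show "continuous_on (closure S) f" using cont cl by (auto simp: S_def intro: continuous_on_subset)
    show "bounded S" unfolding S_def by auto
    show "z \<in> S" using z by (auto simp: S_def)
    fix w assume "w \<in> frontier S"
    hence w: "w \<in> S" "w \<notin> interior S" using cl by (auto simp: frontier_def)
    hence "Im w = 0 \<or> norm w = \<rho>" unfolding int by (auto simp: S_def)
    thus "norm (f w) \<le> B" using w real[of w] circle[of w] by (auto simp: S_def)
  qed
qed

text \<open>A Phragmen-Lindelof principle: the a priori bound \<open>M\<close> may be arbitrarily
  bad, since only the bound on the real line reaches the conclusion. Later \<open>M\<close> comes
  from compactness or depends on an auxiliary segment.\<close>

lemma half_plane_maximum_modulus:
  assumes hol: "f holomorphic_on {z. Im z > 0}" and cont: "continuous_on {z. Im z \<ge> 0} f"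
    and real: "\<And>z. Im z = 0 \<Longrightarrow> norm (f z) \<le> 1"
    and bdd: "\<And>z. Im z \<ge> 0 \<Longrightarrow> norm (f z) \<le> M"
    and z: "Im z \<ge> 0"
  shows "norm (f z) \<le> 1"
proof (rule ccontr)
  assume "\<not> norm (f z) \<le> 1"
  hence gt: "norm (f z) > 1" by simp
  have ge1: "norm (1 - \<i> * w) \<ge> 1" if "Im w \<ge> 0" for w
    using complex_Re_le_cmod[of "1 - \<i> * w"] that by simp
  have nz: "1 - \<i> * w \<noteq> 0" if "Im w \<ge> 0" for w
    using ge1[OF that] by auto
  \<comment> \<open>\<open>f\<^sup>n / (1 - \<i>z)\<close> decays at infinity, and \<open>n\<close> is arbitrary.\<close>
  have "norm (f z) ^ n \<le> norm (1 - \<i> * z)" for n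
  proof -
    \<comment> \<open>On the arc |1 - \<i> w| \<ge> \<rho> - 1 \<ge> |M|^n, so the denominator
      absorbs the crude bound for the n-th power.\<close>
    define \<rho> where "\<rho> = max (norm z) (\<bar>M\<bar> ^ n + 1)"
    have "norm (f z ^ n / (1 - \<i> * z)) \<le> 1"
    proof (rule half_disc_maximum_modulus[where \<rho> = \<rho> and f = "\<lambda>z. f z ^ n / (1 - \<i> * z)"])
      show "(\<lambda>z. f z ^ n / (1 - \<i> * z)) holomorphic_on {z. 0 < Im z}"
        using nz by (intro holomorphic_intros hol) auto
      show "continuous_on {z. 0 \<le> Im z} (\<lambda>z. f z ^ n / (1 - \<i> * z))"
        using nz by (intro continuous_intros cont) auto
    next
      fix w assume w: "Im w = 0"
      have "norm (f w) ^ n \<le> 1" using real[OF w] by (simp add: power_le_one)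
      thus "norm (f w ^ n / (1 - \<i> * w)) \<le> 1"
        using ge1[of w] w by (simp add: norm_divide norm_power divide_le_eq)
    next
      fix w assume w: "Im w \<ge> 0" "norm w = \<rho>"
      have "norm (f w) ^ n \<le> \<bar>M\<bar> ^ n" using bdd[of w] w by (intro power_mono) auto
      also have "\<dots> \<le> \<rho> - 1" by (simp add: \<rho>_def)
      also have "\<dots> \<le> norm (1 - \<i> * w)"
        using norm_triangle_ineq2[of "\<i> * w" 1] w by (simp add: norm_mult norm_minus_commute)
      finally show "norm (f w ^ n / (1 - \<i> * w)) \<le> 1"
        using ge1[of w] w by (simp add: norm_divide norm_power divide_le_eq)
    qed (use z in \<open>auto simp: \<rho>_def\<close>)
    thus ?thesis using ge1[of z] z by (simp add: norm_divide norm_power divide_le_eq split: if_splits)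
  qed
  moreover obtain n where "norm (1 - \<i> * z) < norm (f z) ^ n"
    using real_arch_pow[OF gt] by blast
  ultimately show False by (meson not_less)
qed

text \<open>With a = \<open>q c\<close>, the map sending b to (b - a) / (b + \<open>cnj a\<close>)
  takes the right half-plane to the unit disc and a to 0, so Schwarz's lemma applies to
  \<open>\<phi>\<close>.\<close>

lemma Harnack_ball:
  assumes hol: "q holomorphic_on ball c \<rho>" and pos: "\<And>z. z \<in> ball c \<rho> \<Longrightarrow> Re (q z) > 0"
    and z: "z \<in> ball c \<rho>"
  shows "(\<rho> - dist c z) * Re (q z) \<le> (\<rho> + dist c z) * Re (q c)"
    and "(\<rho> - dist c z) * Re (q c) \<le> (\<rho> + dist c z) * Re (q z)"
proof -
  have rho: "\<rho> > 0" using z by (metis ball_eq_empty empty_iff not_le)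
  define a where "a = q c"
  have a: "Re a > 0" using pos[of c] rho by (simp add: a_def)
  define \<phi> where "\<phi> \<zeta> = (q (c + of_real \<rho> * \<zeta>) - a) / (q (c + of_real \<rho> * \<zeta>) + cnj a)" for \<zeta>
  have mem: "c + of_real \<rho> * \<zeta> \<in> ball c \<rho>" if "norm \<zeta> < 1" for \<zeta>
    using that rho by (simp add: dist_norm norm_mult)
  have nz: "q (c + of_real \<rho> * \<zeta>) + cnj a \<noteq> 0" if "norm \<zeta> < 1" for \<zeta>
  proof
    assume "q (c + of_real \<rho> * \<zeta>) + cnj a = 0"
    hence "Re (q (c + of_real \<rho> * \<zeta>) + cnj a) = 0" by simp
    thus False using pos[OF mem[OF that]] a by simp
  qed
  define t where "t = dist c z / \<rho>"
  define w where "w = \<phi> ((z - c) / of_real \<rho>)"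
  have t: "0 \<le> t" "t < 1" using z rho by (auto simp: t_def divide_less_eq)
  have cz: "norm ((z - c) / of_real \<rho>) = t"
    using rho by (simp add: t_def norm_divide dist_norm norm_minus_commute)
  have "norm w \<le> norm ((z - c) / of_real \<rho>)"
    unfolding w_def
  proof (rule Schwarz_Lemma(1))
    show "\<phi> holomorphic_on ball 0 1"
      unfolding \<phi>_def
      by (intro holomorphic_intros holomorphic_on_compose_gen[OF _ hol, unfolded o_def])
         (use mem nz in auto)
    show "\<phi> 0 = 0" by (simp add: \<phi>_def a_def)
    show "norm ((z - c) / of_real \<rho>) < 1" using cz t by simp
    fix \<zeta> :: complex assume z1: "norm \<zeta> < 1"
    define b where "b = q (c + of_real \<rho> * \<zeta>)"
    have b: "Re b > 0" using pos[OF mem[OF z1]] by (simp add: b_def)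
    have "(norm (b - a))^2 < (norm (b + cnj a))^2"
      unfolding cmod_power2 using mult_pos_pos[OF a b] by (simp add: power2_eq_square algebra_simps)
    hence "norm (b - a) < norm (b + cnj a)" by (rule power_less_imp_less_base) simp
    thus "norm (\<phi> \<zeta>) < 1"
      using nz[OF z1] by (simp add: \<phi>_def b_def norm_divide divide_less_eq)
  qed
  hence wt: "norm w \<le> t" using cz by simp
  define b where "b = q z"
  have b: "Re b > 0" using pos[OF z] by (simp add: b_def)
  have weq: "w = (b - a) / (b + cnj a)" using rho by (simp add: w_def \<phi>_def b_def)
  have nzb: "b + cnj a \<noteq> 0" using a b by (auto simp: complex_eq_iff)
  have "w * (b + cnj a) = b - a" using nzb by (simp add: weq)
  hence "norm (b - a) = norm w * norm (b + cnj a)" by (metis norm_mult)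
  also have "\<dots> \<le> t * norm (b + cnj a)" using wt by (intro mult_right_mono) auto
  finally have "(norm (b - a))^2 \<le> (t * norm (b + cnj a))^2" by (intro power_mono) auto
  hence "(Re b - Re a)^2 + (Im b - Im a)^2 \<le> t^2 * ((Re b + Re a)^2 + (Im b - Im a)^2)"
    unfolding power_mult_distrib cmod_power2 by simp
  moreover have "t^2 * (Im b - Im a)^2 \<le> (Im b - Im a)^2"
    using t by (intro mult_left_le_one_le) (auto simp: power_le_one)
  ultimately have "(Re b - Re a)^2 \<le> (t * (Re b + Re a))^2"
    unfolding power_mult_distrib by (simp only: distrib_left)
  hence "\<bar>Re b - Re a\<bar> \<le> t * (Re b + Re a)"
    using t a b by (subst (asm) abs_le_square_iff[symmetric]) (simp add: abs_mult)
  hence "(1 - t) * Re b \<le> (1 + t) * Re a" "(1 - t) * Re a \<le> (1 + t) * Re b"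
    by (auto simp: abs_le_iff algebra_simps)
  hence "\<rho> * ((1 - t) * Re b) \<le> \<rho> * ((1 + t) * Re a)" "\<rho> * ((1 - t) * Re a) \<le> \<rho> * ((1 + t) * Re b)"
    using rho by auto
  moreover have dist: "dist c z = \<rho> * t" using rho by (simp add: t_def)
  ultimately show "(\<rho> - dist c z) * Re (q z) \<le> (\<rho> + dist c z) * Re (q c)"
    "(\<rho> - dist c z) * Re (q c) \<le> (\<rho> + dist c z) * Re (q z)"
    unfolding dist by (auto simp: a_def b_def algebra_simps)
qed

section \<open>Removal of zeros by Blaschke factors\<close>

lemma entire_factor_zero:
  assumes hol: "F holomorphic_on UNIV" and zero: "F \<mu> = 0" and nz: "F z1 \<noteq> 0"
  obtains m :: nat and F0 where "F0 holomorphic_on UNIV" "F0 \<mu> \<noteq> 0" "\<And>z. F z = (z - \<mu>) ^ m * F0 z"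
proof -
  have "\<not> F constant_on UNIV" using zero nz unfolding constant_on_def by (metis UNIV_I)
  then obtain g r n where g: "0 < n" "0 < r" "g holomorphic_on ball \<mu> r"
    "\<And>w. w \<in> ball \<mu> r \<Longrightarrow> F w = (w - \<mu>) ^ n * g w" "\<And>w. w \<in> ball \<mu> r \<Longrightarrow> g w \<noteq> 0"
    using holomorphic_factor_zero_nonconstant[OF hol open_UNIV connected_UNIV UNIV_I zero] by metis
  define F0 where "F0 z = (if z = \<mu> then g \<mu> else F z / (z - \<mu>) ^ n)" for z
  have eq: "F0 w = g w" if "w \<in> ball \<mu> r" for w using g(4)[OF that] by (auto simp: F0_def)
  have "F0 holomorphic_on ball \<mu> r \<union> (UNIV - {\<mu>})"
  proof (rule holomorphic_on_Un)
    show "F0 holomorphic_on ball \<mu> r" using g(3) by (rule holomorphic_transform) (simp add: eq)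
    have "(\<lambda>z. F z / (z - \<mu>) ^ n) holomorphic_on UNIV - {\<mu>}"
      by (intro holomorphic_intros holomorphic_on_subset[OF hol]) auto
    thus "F0 holomorphic_on UNIV - {\<mu>}"
      by (rule holomorphic_transform) (auto simp: F0_def)
  qed auto
  moreover have "ball \<mu> r \<union> (UNIV - {\<mu>}) = UNIV" using g(2) by auto
  ultimately have "F0 holomorphic_on UNIV" by simp
  moreover have "F0 \<mu> \<noteq> 0" using eq[of \<mu>] g(2,5) by auto
  moreover have "F z = (z - \<mu>) ^ n * F0 z" for z using zero g(1) by (auto simp: F0_def)
  ultimately show ?thesis using that by blast
qed

text \<open>Trading \<open>(z - \<mu>) ^ m\<close> for \<open>(z - cnj \<mu>) ^ m\<close> is
  division by a power of a Blaschke factor, which has modulus 1 on the real line. The boundary bound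
  is unchanged and moves inside once the quotient is known to be bounded: by compactness near
  \<open>\<mu>\<close>, and at distance at least 1 because the two linear factors are comparable
  there. Holomorphy of \<open>P0\<close> is asked only in the open half-plane, so products with
  \<open>k\<close> are covered as well.\<close>

lemma half_plane_divide_Blaschke:
  assumes hol: "P0 holomorphic_on {z. Im z > 0}" and cont: "continuous_on {z. Im z \<ge> 0} P0"
    and bdd: "\<And>z. Im z \<ge> 0 \<Longrightarrow> norm ((z - \<mu>) ^ m * P0 z) \<le> 1"
    and \<mu>: "Im \<mu> > 0" and z: "Im z \<ge> 0"
  shows "norm ((z - cnj \<mu>) ^ m * P0 z) \<le> 1"
proof -
  let ?P = "\<lambda>z. (z - cnj \<mu>) ^ m * P0 z"
  have cont': "continuous_on {z. Im z \<ge> 0} ?P" by (intro continuous_intros cont)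
  have "compact (cball \<mu> 1 \<inter> {z. Im z \<ge> 0})"
    by (intro compact_Int_closed compact_cball closed_halfspace_Im_ge)
  hence "compact (?P ` (cball \<mu> 1 \<inter> {z. Im z \<ge> 0}))"
    by (intro compact_continuous_image continuous_on_subset[OF cont']) auto
  then obtain K where K: "\<And>w. w \<in> cball \<mu> 1 \<Longrightarrow> Im w \<ge> 0 \<Longrightarrow> norm (?P w) \<le> K"
    by (force dest!: compact_imp_bounded simp: bounded_iff)
  show ?thesis
  proof (rule half_plane_maximum_modulus[where f = ?P and M = "max K ((1 + 2 * Im \<mu>) ^ m)"])
    show "?P holomorphic_on {z. Im z > 0}" by (intro holomorphic_intros hol)
    show "continuous_on {z. Im z \<ge> 0} ?P" by (rule cont')
  next
    fix w assume w: "Im w = 0"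
    have "norm (w - cnj \<mu>) = norm (w - \<mu>)" using w by (simp add: cmod_def)
    thus "norm (?P w) \<le> 1" using bdd[of w] w by (simp add: norm_mult norm_power)
  next
    fix w assume w: "Im w \<ge> 0"
    show "norm (?P w) \<le> max K ((1 + 2 * Im \<mu>) ^ m)"
    proof (cases "w \<in> cball \<mu> 1")
      case True thus ?thesis using K w by (simp add: le_max_iff_disj)
    next
      case False
      hence d: "norm (w - \<mu>) \<ge> 1" by (simp add: dist_norm norm_minus_commute)
      have "norm (w - cnj \<mu>) \<le> norm (w - \<mu>) + norm (\<mu> - cnj \<mu>)"
        using norm_triangle_ineq[of "w - \<mu>" "\<mu> - cnj \<mu>"] by simp
      also have "norm (\<mu> - cnj \<mu>) = 2 * Im \<mu>" using \<mu> by (simp add: cmod_def real_sqrt_mult)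
      also have "norm (w - \<mu>) + 2 * Im \<mu> \<le> (1 + 2 * Im \<mu>) * norm (w - \<mu>)"
        using d \<mu> by (simp add: algebra_simps)
      finally have "norm (w - cnj \<mu>) ^ m \<le> ((1 + 2 * Im \<mu>) * norm (w - \<mu>)) ^ m"
        by (intro power_mono) auto
      hence "norm (w - cnj \<mu>) ^ m * norm (P0 w) \<le> ((1 + 2 * Im \<mu>) * norm (w - \<mu>)) ^ m * norm (P0 w)"
        by (rule mult_right_mono) simp
      hence "norm (?P w) \<le> (1 + 2 * Im \<mu>) ^ m * norm ((w - \<mu>) ^ m * P0 w)"
        by (simp add: norm_mult norm_power power_mult_distrib mult.assoc)
      also have "\<dots> \<le> (1 + 2 * Im \<mu>) ^ m * 1"
        using bdd[OF w] \<mu> by (intro mult_left_mono) auto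
      finally show ?thesis by simp
    qed
  qed (use z in auto)
qed

text \<open>Restricting to zeros of norm below \<open>R\<close> leaves finitely many, so induction
  on their number replaces an infinite Blaschke product. Each step moves one zero with its full
  multiplicity to the lower half-plane. This cannot decrease the norm at \<open>z1\<close>, which is
  at least as far from \<open>cnj \<mu>\<close> as from \<open>\<mu>\<close>.\<close>

lemma half_plane_remove_zeros:
  fixes F k :: "complex \<Rightarrow> complex"
  assumes "F holomorphic_on UNIV"
    and k: "k holomorphic_on {z. Im z > 0}" "continuous_on {z. Im z \<ge> 0} k"
    and "\<And>z. Im z \<ge> 0 \<Longrightarrow> norm (F z) \<le> 1"
    and "\<And>z. Im z \<ge> 0 \<Longrightarrow> norm (k z * F z) \<le> 1"
    and z1: "Im z1 > 0" and "F z1 \<noteq> 0"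
  shows "\<exists>F1. F1 holomorphic_on UNIV \<and> (\<forall>z. Im z \<ge> 0 \<longrightarrow> norm (F1 z) \<le> 1) \<and>
      (\<forall>z. Im z \<ge> 0 \<longrightarrow> norm (k z * F1 z) \<le> 1) \<and> norm (F z1) \<le> norm (F1 z1) \<and>
      (\<forall>z. Im z > 0 \<longrightarrow> norm z < R \<longrightarrow> F1 z \<noteq> 0)"
  using assms(1,4,5,7)
proof (induction "card {z. Im z > 0 \<and> norm z < R \<and> F z = 0}" arbitrary: F rule: less_induct)
  case less
  let ?Z = "\<lambda>F. {z. Im z > 0 \<and> norm z < R \<and> F z = 0}"
  show ?case
  proof (cases "?Z F = {}")
    case True
    with less.prems show ?thesis by blast
  next
    case False
    then obtain \<mu> where \<mu>: "Im \<mu> > 0" "norm \<mu> < R" "F \<mu> = 0" by blast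
    obtain m F0 where F0: "F0 holomorphic_on UNIV" "F0 \<mu> \<noteq> 0" "\<And>z. F z = (z - \<mu>) ^ m * F0 z"
      using entire_factor_zero[OF less.prems(1) \<mu>(3) less.prems(4)] by blast
    define F1 where "F1 z = (z - cnj \<mu>) ^ m * F0 z" for z
    have F0c: "continuous_on A F0" for A
      using F0(1) holomorphic_on_imp_continuous_on continuous_on_subset by blast
    have F0h: "F0 holomorphic_on A" for A using F0(1) holomorphic_on_subset by blast
    have h1: "F1 holomorphic_on UNIV" unfolding F1_def by (intro holomorphic_intros F0)
    have b1: "norm (F1 z) \<le> 1" if "Im z \<ge> 0" for z
      unfolding F1_def using less.prems(2) \<mu>(1) that
      by (intro half_plane_divide_Blaschke F0c F0h) (auto simp: F0(3))
    have b2: "norm (k z * F1 z) \<le> 1" if "Im z \<ge> 0" for z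
    proof -
      have "norm ((z - cnj \<mu>) ^ m * (k z * F0 z)) \<le> 1"
        using less.prems(3) \<mu>(1) that
        by (intro half_plane_divide_Blaschke continuous_intros holomorphic_intros k F0c F0h)
           (auto simp: F0(3) mult_ac)
      thus ?thesis by (simp add: F1_def mult_ac)
    qed
    have "(norm (z1 - \<mu>))^2 \<le> (norm (z1 - cnj \<mu>))^2"
      unfolding cmod_power2 using mult_pos_pos[OF z1 \<mu>(1)] by (simp add: power2_eq_square algebra_simps)
    hence "norm (z1 - \<mu>) \<le> norm (z1 - cnj \<mu>)" by (rule power2_le_imp_le) simp
    hence b3: "norm (F z1) \<le> norm (F1 z1)"
      by (simp add: F0(3) F1_def norm_mult norm_power mult_right_mono power_mono)
    have ne: "x \<noteq> cnj \<mu>" if "Im x > 0" for x using that \<mu>(1) by (auto simp: complex_eq_iff)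
    have Zeq: "?Z F1 \<subseteq> ?Z F - {\<mu>}"
    proof
      fix x assume "x \<in> ?Z F1"
      hence x: "Im x > 0" "norm x < R" "F1 x = 0" by auto
      hence "F0 x = 0" using ne[OF x(1)] by (simp add: F1_def)
      thus "x \<in> ?Z F - {\<mu>}" using F0(2) F0(3)[of x] x by auto
    qed
    have "\<not> F constant_on UNIV" using \<mu>(3) less.prems(4) unfolding constant_on_def by (metis UNIV_I)
    hence "finite {z \<in> cball 0 R. F z = 0}"
      using less.prems(1) by (intro holomorphic_compact_finite_zeros) auto
    hence fin: "finite (?Z F)" by (rule rev_finite_subset) auto
    have "card (?Z F1) \<le> card (?Z F - {\<mu>})" using fin Zeq by (intro card_mono) auto
    also have "\<dots> < card (?Z F)" using fin \<mu> by (intro card_Diff1_less) auto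
    finally have "card (?Z F1) < card (?Z F)" .
    moreover have "F1 z1 \<noteq> 0" using b3 less.prems(4) by auto
    ultimately obtain F2 where "F2 holomorphic_on UNIV" "\<forall>z. Im z \<ge> 0 \<longrightarrow> norm (F2 z) \<le> 1"
      "\<forall>z. Im z \<ge> 0 \<longrightarrow> norm (k z * F2 z) \<le> 1" "norm (F1 z1) \<le> norm (F2 z1)"
      "\<forall>z. Im z > 0 \<longrightarrow> norm z < R \<longrightarrow> F2 z \<noteq> 0"
      using less.hyps[OF _ h1 b1 b2] by blast
    thus ?thesis using b3 by (intro exI[of _ F2]) auto
  qed
qed

section \<open>Barriers in boxes standing on the real line\<close>

lemma box_maximum_modulus:
  assumes hol: "f holomorphic_on {z. 0 < Im z \<and> \<bar>Re z\<bar> \<le> r}"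
    and cont: "continuous_on {z. 0 \<le> Im z \<and> \<bar>Re z\<bar> \<le> r} f"
    and bot: "\<And>z. Im z = 0 \<Longrightarrow> \<bar>Re z\<bar> \<le> r \<Longrightarrow> norm (f z) \<le> B"
    and top: "\<And>z. Im z = r \<Longrightarrow> \<bar>Re z\<bar> \<le> r \<Longrightarrow> norm (f z) \<le> B"
    and side: "\<And>z. 0 \<le> Im z \<Longrightarrow> Im z \<le> r \<Longrightarrow> \<bar>Re z\<bar> = r \<Longrightarrow> norm (f z) \<le> B"
    and z: "0 \<le> Im z" "Im z \<le> r" "\<bar>Re z\<bar> \<le> r"
  shows "norm (f z) \<le> B"
proof -
  define S where "S = cbox (Complex (- r) 0) (Complex r r)"
  have mem: "w \<in> S \<longleftrightarrow> 0 \<le> Im w \<and> Im w \<le> r \<and> \<bar>Re w\<bar> \<le> r" for w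
    by (auto simp: S_def in_cbox_complex_iff)
  have int: "w \<in> interior S \<longleftrightarrow> 0 < Im w \<and> Im w < r \<and> \<bar>Re w\<bar> < r" for w
    by (auto simp: S_def interior_cbox in_box_complex_iff)
  have cl: "closed S" unfolding S_def by (rule closed_cbox)
  show ?thesis
  proof (rule maximum_modulus_frontier[where S = S and f = f])
    show "f holomorphic_on interior S" using hol by (rule holomorphic_on_subset) (auto simp: int)
    show "continuous_on (closure S) f"
      using cl by (intro continuous_on_subset[OF cont]) (auto simp: mem)
    show "bounded S" unfolding S_def by (rule bounded_cbox)
    show "z \<in> S" using z by (simp add: mem)
    fix w assume "w \<in> frontier S"
    hence w: "w \<in> S" "w \<notin> interior S" using cl by (auto simp: frontier_def)
    hence "Im w = 0 \<or> Im w = r \<or> \<bar>Re w\<bar> = r" unfolding int mem by auto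
    thus "norm (f w) \<le> B" using w bot[of w] top[of w] side[of w] by (auto simp: mem)
  qed
qed

text \<open>The barriers \<open>\<beta>\<close> below are real parts of holomorphic functions, so that comparing
  \<open>ln |k|\<close> with \<open>\<beta>\<close> is the maximum modulus principle for \<open>k\<close> times an exponential.\<close>

lemma corner_barrier:
  fixes s t :: real
  assumes "s > 0" "t \<ge> 0"
  shows "1 / (s + t) \<le> (s + t) / (s\<^sup>2 + t\<^sup>2)"
proof -
  have "s\<^sup>2 + t\<^sup>2 > 0" using assms by (simp add: add_pos_nonneg)
  moreover have "s\<^sup>2 + t\<^sup>2 \<le> (s + t) * (s + t)" using assms by (simp add: power2_eq_square algebra_simps)
  ultimately show ?thesis using assms by (simp add: field_simps)
qed

text \<open>The given bound degenerates where the vertical sides meet the real line. The barrier has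
  poles next to these two corners and is at least the inverse of the distance sum there, so it
  dominates A / Im z along the sides and stays nonnegative on the bottom edge. On the half-size box,
  far from the poles, it is only of order 1 / r.\<close>

lemma box_bound_from_inverse_height:
  assumes hol: "k holomorphic_on {z. Im z > 0}" and cont: "continuous_on {z. Im z \<ge> 0} k"
    and r: "r > 0" and A: "A > 0"
    and real: "\<And>z. Im z = 0 \<Longrightarrow> norm (k z) \<le> 1"
    and bd: "\<And>z. 0 < Im z \<Longrightarrow> Im z \<le> r \<Longrightarrow> \<bar>Re z\<bar> \<le> r \<Longrightarrow> norm (k z) \<le> exp (A / Im z)"
    and z: "0 \<le> Im z" "Im z \<le> r / 2" "\<bar>Re z\<bar> \<le> r / 2"
  shows "norm (k z) \<le> exp (24 * A / r)"
proof -
  define S where "S = cbox (Complex (- r) 0) (Complex r r)"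
  have mem: "w \<in> S \<longleftrightarrow> 0 \<le> Im w \<and> Im w \<le> r \<and> \<bar>Re w\<bar> \<le> r" for w
    by (auto simp: S_def in_cbox_complex_iff)
  have "compact (k ` S)"
    unfolding S_def by (intro compact_continuous_image compact_cbox continuous_on_subset[OF cont])
      (auto simp: in_cbox_complex_iff)
  then obtain K where K: "\<And>w. w \<in> S \<Longrightarrow> norm (k w) \<le> K"
    by (force dest!: compact_imp_bounded simp: bounded_iff)
  define L where "L = max 1 K"
  have L: "norm (k w) \<le> exp L" if "w \<in> S" for w
    using K[OF that] exp_ge_add_one_self[of L] max.cobounded2[of K 1] unfolding L_def by linarith
  have L1: "L \<ge> 1" by (simp add: L_def)
  define \<delta> where "\<delta> = min r (A / L)"
  have \<delta>: "\<delta> > 0" "\<delta> \<le> r" "L \<le> A / \<delta>"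
    using r A L1 by (auto simp: \<delta>_def min_def field_simps)
  \<comment> \<open>The poles of the barrier are moved off the corners of the box by \<open>\<delta>\<close>; within distance \<open>\<delta>\<close> of a
    corner the crude bound \<open>L\<close> suffices.\<close>
  define p where "p = r + \<delta>"
  have p: "p > r" "p \<le> 2 * r" using \<delta> by (auto simp: p_def)
  \<comment> \<open>With s = p - Re z and t = Im z the first summand has real part (s + t) / (s^2 +
    t^2); the second is its mirror image. A real numerator would leave s / (s^2 + t^2), which is too
    small on the sides, where s = \<delta>, once t is much larger than \<delta>.\<close>
  define E where "E z = (-1 + \<i>) / (z - of_real p) + (1 + \<i>) / (z + of_real p)" for z :: complex
  define \<beta> where "\<beta> z = Re (E z)" for z
  have Re1: "Re ((-1 + \<i>) / (w - of_real p)) = ((p - Re w) + Im w) / ((p - Re w)\<^sup>2 + (Im w)\<^sup>2)" for w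
    by (simp add: Re_divide power2_eq_square algebra_simps)
  have Re2: "Re ((1 + \<i>) / (w + of_real p)) = ((p + Re w) + Im w) / ((p + Re w)\<^sup>2 + (Im w)\<^sup>2)" for w
    by (simp add: Re_divide power2_eq_square algebra_simps)
  have b1: "1 / ((p - Re w) + Im w) \<le> \<beta> w" "1 / ((p + Re w) + Im w) \<le> \<beta> w" "0 \<le> \<beta> w"
    if "w \<in> S" for w
  proof -
    have s: "p - Re w > 0" "p + Re w > 0" "Im w \<ge> 0" using that p by (auto simp: mem)
    have "0 \<le> 1 / ((p - Re w) + Im w)" "0 \<le> 1 / ((p + Re w) + Im w)" using s by auto
    thus "1 / ((p - Re w) + Im w) \<le> \<beta> w" "1 / ((p + Re w) + Im w) \<le> \<beta> w" "0 \<le> \<beta> w"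
      using corner_barrier[OF s(1) s(3)] corner_barrier[OF s(2) s(3)]
      unfolding \<beta>_def E_def plus_complex.sel Re1 Re2 by linarith+
  qed
  have nz: "w - of_real p \<noteq> 0" "w + of_real p \<noteq> 0" if "\<bar>Re w\<bar> \<le> r" for w :: complex
    using that p by (auto simp: complex_eq_iff)
  \<comment> \<open>The factor 4 comes from the top edge, where the available lower bound for
    \<open>\<beta>\<close> is 1 / (4 r).\<close>
  define f where "f w = k w * exp (- (4 * A) * E w)" for w
  have nf: "norm (f w) = norm (k w) * exp (- (4 * A * \<beta> w))" for w
    by (simp add: f_def norm_mult \<beta>_def)
  have good: "norm (f w) \<le> 1" if "norm (k w) \<le> exp c" "c \<le> 4 * A * \<beta> w" for w c
  proof -
    have "norm (k w) \<le> exp (4 * A * \<beta> w)" using that by (meson exp_le_cancel_iff order_trans)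
    thus ?thesis unfolding nf exp_minus by (simp add: field_simps)
  qed
  have top: "norm (f w) \<le> 1" if "Im w = r" "\<bar>Re w\<bar> \<le> r" for w
  proof (rule good)
    show "norm (k w) \<le> exp (A / r)" using bd[of w] that r by simp
    have "1 / (4 * r) \<le> 1 / ((p - Re w) + Im w)"
      using that p r by (intro divide_left_mono mult_pos_pos) auto
    also have "\<dots> \<le> \<beta> w" using that r by (intro b1) (auto simp: mem)
    finally show "A / r \<le> 4 * A * \<beta> w" using A r by (simp add: field_simps)
  qed
  have side: "norm (f w) \<le> 1" if w: "0 \<le> Im w" "Im w \<le> r" "\<bar>Re w\<bar> = r" for w
  proof -
    have wS: "w \<in> S" using w by (simp add: mem)
    have "1 / (\<delta> + Im w) \<le> \<beta> w"
      using b1(1,2)[OF wS] w(3) by (cases "Re w \<ge> 0") (auto simp: p_def)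
    hence b: "4 * A / (\<delta> + Im w) \<le> 4 * A * \<beta> w"
      using A mult_left_mono[of "1 / (\<delta> + Im w)" "\<beta> w" "4 * A"] by simp
    show ?thesis
    proof (cases "Im w \<le> \<delta>")
      case True
      show ?thesis
      proof (rule good)
        show "norm (k w) \<le> exp (A / \<delta>)" using L[OF wS] \<delta>(3) by (meson exp_le_cancel_iff order_trans)
        have "A / \<delta> \<le> 4 * A / (\<delta> + Im w)"
          using True A \<delta>(1) w(1) by (simp add: frac_le_eq divide_le_0_iff field_simps)
        thus "A / \<delta> \<le> 4 * A * \<beta> w" using b by linarith
      qed
    next
      case False
      show ?thesis
      proof (rule good)
        show "norm (k w) \<le> exp (A / Im w)" using bd[of w] w False \<delta>(1) by auto
        have "A / Im w \<le> 4 * A / (\<delta> + Im w)"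
          using False A \<delta>(1) w(1) by (simp add: field_simps)
        thus "A / Im w \<le> 4 * A * \<beta> w" using b by linarith
      qed
    qed
  qed
  have bot: "norm (f w) \<le> 1" if "Im w = 0" "\<bar>Re w\<bar> \<le> r" for w
    using good[of w 0] real[of w] that b1(3)[of w] A r by (auto simp: mem)
  have "norm (f z) \<le> 1"
  proof (rule box_maximum_modulus[where f = f and r = r])
    show "f holomorphic_on {z. 0 < Im z \<and> \<bar>Re z\<bar> \<le> r}" unfolding f_def E_def
      by (intro holomorphic_intros holomorphic_on_subset[OF hol]) (use nz in auto)
    show "continuous_on {z. 0 \<le> Im z \<and> \<bar>Re z\<bar> \<le> r} f" unfolding f_def E_def
      by (intro continuous_intros continuous_on_subset[OF cont]) (use nz in auto)
  qed (use top side bot z r in auto)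
  hence "norm (k z) \<le> exp (4 * A * \<beta> z)" unfolding nf exp_minus by (simp add: field_simps)
  moreover have "4 * A * \<beta> z \<le> 24 * A / r"
  proof -
    \<comment> \<open>3/2 stands in for the square root of 2. Both poles are at distance at least r
      / 2, so each summand contributes at most 3 / r, and 4 A times 6 / r is the final
      exponent.\<close>
    have n2: "norm (-1 + \<i>) \<le> 3 / 2" "norm (1 + \<i>) \<le> 3 / 2"
      by (auto intro!: power2_le_imp_le[of "norm (_ :: complex)"] simp only: cmod_power2)
         (auto simp: power2_eq_square)
    have "norm (z - of_real p) \<ge> r / 2" "norm (z + of_real p) \<ge> r / 2"
      using abs_Re_le_cmod[of "z - of_real p"] abs_Re_le_cmod[of "z + of_real p"] z p by auto
    note ge = this
    have "norm ((-1 + \<i>) / (z - of_real p)) \<le> (3 / 2) / (r / 2)"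
      unfolding norm_divide by (rule frac_le) (use n2 r ge in auto)
    moreover have "norm ((1 + \<i>) / (z + of_real p)) \<le> (3 / 2) / (r / 2)"
      unfolding norm_divide by (rule frac_le) (use n2 r ge in auto)
    ultimately have "norm (E z) \<le> 6 / r"
      unfolding E_def using norm_triangle_ineq[of "(-1 + \<i>) / (z - of_real p)" "(1 + \<i>) / (z + of_real p)"]
      by simp
    hence "\<beta> z \<le> 6 / r" unfolding \<beta>_def using complex_Re_le_cmod[of "E z"] by linarith
    hence "4 * A * \<beta> z \<le> 4 * A * (6 / r)" using A by (intro mult_left_mono) auto
    thus ?thesis by simp
  qed
  ultimately show ?thesis by (meson exp_le_cancel_iff order_trans)
qed

text \<open>The barrier is nonnegative on the bottom edge and at least 1 on the other three: the
  term (Re z)^2 / r^2 handles the sides, and the linear term outweighs -(Im z)^2 / r^2. It equals 2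
  Im z / r up to a term quadratic in z, so when A is proportional to r the exponent becomes
  proportional to Im z as r grows.\<close>

lemma box_bound_linear_in_height:
  assumes hol: "k holomorphic_on {z. Im z > 0}" and cont: "continuous_on {z. Im z \<ge> 0} k"
    and r: "r > 0" and A: "A \<ge> 0"
    and real: "\<And>z. Im z = 0 \<Longrightarrow> norm (k z) \<le> 1"
    and bd: "\<And>z. 0 \<le> Im z \<Longrightarrow> Im z \<le> r \<Longrightarrow> \<bar>Re z\<bar> \<le> r \<Longrightarrow> norm (k z) \<le> exp A"
    and z: "0 \<le> Im z" "Im z \<le> r" "\<bar>Re z\<bar> \<le> r"
  shows "norm (k z) \<le> exp (A * (2 * Im z / r + ((Re z)\<^sup>2 - (Im z)\<^sup>2) / r\<^sup>2))"
proof -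
  define \<beta> where "\<beta> z = 2 * Im z / r + ((Re z)\<^sup>2 - (Im z)\<^sup>2) / r\<^sup>2" for z
  define f where "f z = k z * exp (- of_real A * (- 2 * \<i> * z / of_real r + z\<^sup>2 / of_real (r\<^sup>2)))" for z
  have nf: "norm (f w) = norm (k w) * exp (- (A * \<beta> w))" for w
    by (simp add: f_def norm_mult \<beta>_def Re_divide_of_real Re_power2 flip: of_real_power)
  have good: "norm (f w) \<le> 1" if "norm (k w) \<le> exp c" "c \<le> A * \<beta> w" for w c
  proof -
    have "norm (k w) \<le> exp (A * \<beta> w)" using that by (meson exp_le_cancel_iff order_trans)
    thus ?thesis unfolding nf exp_minus by (simp add: field_simps)
  qed
  have "norm (f z) \<le> 1"
  proof (rule box_maximum_modulus[where f = f and r = r])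
    show "f holomorphic_on {z. 0 < Im z \<and> \<bar>Re z\<bar> \<le> r}" unfolding f_def
      using r by (intro holomorphic_intros holomorphic_on_subset[OF hol]) auto
    show "continuous_on {z. 0 \<le> Im z \<and> \<bar>Re z\<bar> \<le> r} f" unfolding f_def
      using r by (intro continuous_intros continuous_on_subset[OF cont]) auto
  next
    fix w assume w: "Im w = 0"
    show "norm (f w) \<le> 1" using good[of w 0] real[OF w] w A by (simp add: \<beta>_def)
  next
    fix w assume w: "Im w = r" "\<bar>Re w\<bar> \<le> r"
    have "\<beta> w = 1 + (Re w)\<^sup>2 / r\<^sup>2" using w r by (simp add: \<beta>_def field_simps)
    hence "1 \<le> \<beta> w" by simp
    thus "norm (f w) \<le> 1" using good[of w A] bd[of w] w r A mult_left_mono[of 1 "\<beta> w" A] by simp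
  next
    fix w assume w: "0 \<le> Im w" "Im w \<le> r" "\<bar>Re w\<bar> = r"
    have "(Re w)\<^sup>2 = r\<^sup>2" using w by (metis power2_abs)
    hence "\<beta> w = 1 + (2 * r * Im w - Im w * Im w) / r\<^sup>2"
      using r by (simp add: \<beta>_def field_simps power2_eq_square)
    moreover have "Im w * Im w \<le> 2 * r * Im w" using w r by (intro mult_right_mono) auto
    ultimately have "1 \<le> \<beta> w" by simp
    thus "norm (f w) \<le> 1" using good[of w A] bd[of w] w r A mult_left_mono[of 1 "\<beta> w" A] by simp
  qed (use r z in auto)
  thus ?thesis unfolding nf exp_minus \<beta>_def by (simp add: field_simps)
qed

section \<open>From one good point to the whole half-plane\<close>

text \<open>Harnack's inequality is used along the chain \<open>z1\<close>, \<open>c\<close>,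
  \<open>e\<close>, \<open>z\<close>, in balls tangent to the real line that lie in the zero-free
  half-disc \<open>D\<close>. The relation between \<open>R\<close> and \<open>z1\<close> puts
  \<open>z1\<close> inside the ball around \<open>c\<close> with room to spare. The conclusion
  contains \<epsilon> but not \<open>z1\<close>, which matters because the position of
  \<open>z1\<close> is not controlled in terms of \<epsilon>.\<close>

lemma half_plane_bound_inverse_height:
  fixes F k :: "complex \<Rightarrow> complex"
  assumes F: "F holomorphic_on UNIV"
    and k: "k holomorphic_on {z. Im z > 0}" "continuous_on {z. Im z \<ge> 0} k"
    and F1: "\<And>z. Im z \<ge> 0 \<Longrightarrow> norm (F z) \<le> 1"
    and kF: "\<And>z. Im z \<ge> 0 \<Longrightarrow> norm (k z * F z) \<le> 1"
    and z1: "Im z1 > 0" and \<epsilon>: "\<epsilon> > 0" "norm (F z1) \<ge> exp (- \<epsilon> * Im z1)"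
    and R: "R > 0" "2 * (norm z1)\<^sup>2 \<le> R * Im z1"
    and z: "0 < Im z" "Im z \<le> R / 4" "\<bar>Re z\<bar> \<le> R / 4"
  shows "norm (k z) \<le> exp (12 * \<epsilon> * R\<^sup>2 / Im z)"
proof -
  have "F z1 \<noteq> 0" using \<epsilon>(2) by auto
  then obtain G where G: "G holomorphic_on UNIV" "\<And>z. Im z \<ge> 0 \<Longrightarrow> norm (G z) \<le> 1"
    "\<And>z. Im z \<ge> 0 \<Longrightarrow> norm (k z * G z) \<le> 1" "norm (F z1) \<le> norm (G z1)"
    "\<And>z. Im z > 0 \<Longrightarrow> norm z < R \<Longrightarrow> G z \<noteq> 0"
    using half_plane_remove_zeros[OF F k F1 kF z1, of R] by blast
  define D where "D = ball 0 R \<inter> {z. Im z > 0}"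
  have D: "convex D" "open D" unfolding D_def
    by (auto intro!: convex_Int convex_halfspace_Im_gt open_Int open_halfspace_Im_gt)
  have sub: "ball (Complex x h) h \<subseteq> D" if "\<bar>x\<bar> + 2 * h \<le> R" for x h
  proof
    fix w assume w: "w \<in> ball (Complex x h) h"
    hence h: "norm (w - Complex x h) < h" by (simp add: dist_norm norm_minus_commute)
    have "Im w > 0" using abs_Im_le_cmod[of "w - Complex x h"] h by simp
    moreover have "norm (Complex x h) \<le> \<bar>x\<bar> + \<bar>h\<bar>" using cmod_le[of "Complex x h"] by simp
    hence "norm w < R"
      using norm_triangle_ineq[of "w - Complex x h" "Complex x h"] h that norm_ge_zero[of "w - Complex x h"]
      unfolding diff_add_cancel by linarith
    ultimately show "w \<in> D" by (simp add: D_def)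
  qed
  have "Complex 0 (R / 2) \<in> D" using R by (simp add: D_def cmod_def)
  then obtain g where g: "g holomorphic_on D" "\<And>x. x \<in> D \<Longrightarrow> exp (g x) = G x"
    using holomorphic_logarithm_exists[OF D holomorphic_on_subset[OF G(1) subset_UNIV]] G(5)
    unfolding D_def by (metis IntE mem_Collect_eq mem_ball_0)
  \<comment> \<open>The added constant makes \<open>Re q\<close> strictly positive at the cost of doubling its bound at \<open>z1\<close>.\<close>
  define q where "q w = - g w + of_real (\<epsilon> * Im z1)" for w
  have qh: "q holomorphic_on D" unfolding q_def by (intro holomorphic_intros g)
  have nG: "norm (G w) = exp (- Re (q w) + \<epsilon> * Im z1)" if "w \<in> D" for w
    using g(2)[OF that, symmetric] by (simp add: q_def)
  have pos: "Re (q w) > 0" if "w \<in> D" for w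
  proof -
    have "exp (- Re (q w) + \<epsilon> * Im z1) \<le> exp 0" using nG[OF that] G(2)[of w] that by (simp add: D_def)
    thus ?thesis using mult_pos_pos[OF \<epsilon>(1) z1] by (simp only: exp_le_cancel_iff)
  qed
  have z1R: "norm z1 < R"
  proof -
    have "2 * (norm z1)\<^sup>2 \<le> R * norm z1"
      using R(2) mult_left_mono[of "Im z1" "norm z1" R] abs_Im_le_cmod[of z1] R(1) by linarith
    moreover have "norm z1 > 0" using z1 abs_Im_le_cmod[of z1] by linarith
    ultimately have "2 * norm z1 \<le> R" by (simp add: power2_eq_square)
    thus ?thesis using R(1) by linarith
  qed
  have z1D: "z1 \<in> D" using z1R z1 by (simp add: D_def)
  have q1: "Re (q z1) \<le> 2 * \<epsilon> * Im z1"
  proof -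
    have "exp (- \<epsilon> * Im z1) \<le> exp (- Re (q z1) + \<epsilon> * Im z1)" using nG[OF z1D] \<epsilon>(2) G(4) by linarith
    thus ?thesis unfolding exp_le_cancel_iff by simp
  qed
  define c where "c = Complex 0 (R / 2)"
  have subc: "ball c (R / 2) \<subseteq> D" unfolding c_def using R by (intro sub) simp
  have pc: "Re (q c) > 0" using subc R(1) by (intro pos) auto
  \<comment> \<open>Tangency makes (R / 2)^2 - d^2 at least R Im z1 / 2. The Harnack factor is thus
    of order R / Im z1, and it meets the bound 2 \<epsilon> Im z1, so Im z1 cancels.\<close>
  have qc: "Re (q c) \<le> 4 * \<epsilon> * R"
  proof -
    define d where "d = dist c z1"
    have "d\<^sup>2 = (Re z1)\<^sup>2 + (R / 2 - Im z1)\<^sup>2" by (simp add: d_def c_def dist_norm cmod_power2)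
    also have "\<dots> = (norm z1)\<^sup>2 + (R / 2)\<^sup>2 - R * Im z1" unfolding cmod_power2 by (simp add: power2_eq_square algebra_simps)
    finally have d2: "R * Im z1 \<le> 2 * ((R / 2)\<^sup>2 - d\<^sup>2)" using R(2) by simp
    hence "0 < 2 * ((R / 2)\<^sup>2 - d\<^sup>2)" using mult_pos_pos[OF R(1) z1] by (rule less_le_trans[rotated])
    hence "d\<^sup>2 < (R / 2)\<^sup>2" unfolding zero_less_mult_iff by auto
    hence dR: "d < R / 2" using R(1) by (intro power_less_imp_less_base[of d 2]) auto
    have d0: "d \<ge> 0" by (simp add: d_def)
    have "(R / 2 - d) * Re (q c) \<le> (R / 2 + d) * Re (q z1)"
      unfolding d_def using dR pos subc
      by (intro Harnack_ball(2) holomorphic_on_subset[OF qh]) (auto simp: d_def)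
    hence "(R / 2 + d) * ((R / 2 - d) * Re (q c)) \<le> (R / 2 + d) * ((R / 2 + d) * Re (q z1))"
      using d0 R(1) by (intro mult_left_mono) auto
    also have "\<dots> = (R / 2 + d)\<^sup>2 * Re (q z1)" by (simp add: power2_eq_square)
    also have "\<dots> \<le> R\<^sup>2 * (2 * \<epsilon> * Im z1)"
      using q1 pos[OF z1D] dR d0 by (intro mult_mono power_mono) auto
    finally have "((R / 2)\<^sup>2 - d\<^sup>2) * Re (q c) \<le> R\<^sup>2 * (2 * \<epsilon> * Im z1)"
      by (simp add: power2_eq_square algebra_simps)
    moreover have "R * Im z1 * Re (q c) \<le> 2 * ((R / 2)\<^sup>2 - d\<^sup>2) * Re (q c)"
      using d2 pc by (intro mult_right_mono) auto
    ultimately have "R * Im z1 * Re (q c) \<le> R * Im z1 * (4 * \<epsilon> * R)"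
      by (simp add: power2_eq_square algebra_simps)
    thus ?thesis using R(1) z1 by (subst (asm) mult_le_cancel_left_pos) auto
  qed
  define e where "e = Complex (Re z) (R / 4)"
  have qe: "Re (q e) \<le> 24 * \<epsilon> * R"
  proof -
    define d where "d = dist c e"
    have "d\<^sup>2 = (Re z)\<^sup>2 + (R / 4)\<^sup>2" by (simp add: d_def c_def e_def dist_norm cmod_power2)
    also have "\<dots> \<le> (R / 4)\<^sup>2 + (R / 4)\<^sup>2"
      using power_mono[OF z(3), of 2] by simp
    \<comment> \<open>5/14 lies slightly above 1 / sqrt 8 and makes the Harnack ratio (1/2 + 5/14) /
      (1/2 - 5/14) exactly 6, whence 24 = 6 * 4.\<close>
    also have "\<dots> \<le> (5 / 14 * R)\<^sup>2" by (simp add: power2_eq_square field_simps)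
    finally have d: "d \<le> 5 / 14 * R" by (rule power2_le_imp_le) (use R(1) in simp)
    have e: "e \<in> ball c (R / 2)" using d R(1) by (simp add: d_def)
    hence "(R / 2 - d) * Re (q e) \<le> (R / 2 + d) * Re (q c)"
      unfolding d_def using pos subc
      by (intro Harnack_ball(1) holomorphic_on_subset[OF qh]) auto
    moreover have pe: "Re (q e) > 0" using e subc by (intro pos) auto
    moreover have "R / 7 * Re (q e) \<le> (R / 2 - d) * Re (q e)"
      using d pe by (intro mult_right_mono) auto
    moreover have "(R / 2 + d) * Re (q c) \<le> 6 * R / 7 * (4 * \<epsilon> * R)"
      using d qc pc R(1) \<epsilon>(1) by (intro mult_mono) auto
    moreover have "6 * R / 7 * (4 * \<epsilon> * R) = R / 7 * (24 * \<epsilon> * R)" by simp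
    ultimately have "R / 7 * Re (q e) \<le> R / 7 * (24 * \<epsilon> * R)" by linarith
    thus ?thesis using R(1) by (subst (asm) mult_le_cancel_left_pos) auto
  qed
  have zD: "z \<in> D"
    using cmod_le[of z] z R(1) by (simp add: D_def)
  have qz: "Re (q z) \<le> 12 * \<epsilon> * R\<^sup>2 / Im z"
  proof -
    define d where "d = dist e z"
    \<comment> \<open>\<open>e\<close> lies straight above \<open>z\<close> at a height equal to the
      radius, so the gap between \<open>d\<close> and the radius is Im z. This is the source of the
      denominator in the conclusion.\<close>
    have d: "d = R / 4 - Im z" using z by (simp add: d_def e_def dist_norm cmod_def)
    have sub': "ball e (R / 4) \<subseteq> D" unfolding e_def using z by (intro sub) auto
    have pe: "Re (q e) > 0" using sub' R(1) by (intro pos) auto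
    have "z \<in> ball e (R / 4)" using d z by (simp add: d_def)
    hence "(R / 4 - d) * Re (q z) \<le> (R / 4 + d) * Re (q e)"
      unfolding d_def using pos sub'
      by (intro Harnack_ball(1) holomorphic_on_subset[OF qh]) auto
    also have "\<dots> \<le> R / 2 * (24 * \<epsilon> * R)"
      using d qe pe z R(1) by (intro mult_mono) auto
    finally have "Im z * Re (q z) \<le> 12 * \<epsilon> * R\<^sup>2" by (simp add: d power2_eq_square mult_ac)
    thus ?thesis using z(1) by (simp add: field_simps)
  qed
  have "norm (k z) * exp (- Re (q z)) \<le> norm (k z) * exp (- Re (q z) + \<epsilon> * Im z1)"
    using \<epsilon> z1 by (intro mult_left_mono) auto
  also have "\<dots> = norm (k z * G z)" using nG[OF zD] by (simp add: norm_mult)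
  also have "\<dots> \<le> 1" using G(3) z by simp
  finally have "norm (k z) \<le> exp (Re (q z))" by (simp add: exp_minus field_simps)
  thus ?thesis using qz by (meson exp_le_cancel_iff order_trans)
qed

text \<open>The three estimates are chained on boxes of size R / 4, R / 8 and again R / 8. The
  exponent 12 \<epsilon> R^2 / Im w turns into 24 * 12 \<epsilon> R^2 / (R / 4) = 1152 \<epsilon> R
  and then into 1152 \<epsilon> (16 Im z + O(1 / R)). Letting \<open>R\<close> grow gives 18432
  \<epsilon> Im z, and \<epsilon> is then free to vanish. \<open>type\<close> says that
  \<open>F\<close> has no exponential decay in the half-plane.\<close>

lemma half_plane_quotient_bound:
  fixes F k :: "complex \<Rightarrow> complex"
  assumes F: "F holomorphic_on UNIV"
    and k: "k holomorphic_on {z. Im z > 0}" "continuous_on {z. Im z \<ge> 0} k"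
    and F1: "\<And>z. Im z \<ge> 0 \<Longrightarrow> norm (F z) \<le> 1"
    and kF: "\<And>z. Im z \<ge> 0 \<Longrightarrow> norm (k z * F z) \<le> 1"
    and real: "\<And>z. Im z = 0 \<Longrightarrow> norm (k z) \<le> 1"
    and type: "\<And>\<epsilon>. \<epsilon> > 0 \<Longrightarrow> \<exists>z1. Im z1 > 0 \<and> norm (F z1) \<ge> exp (- \<epsilon> * Im z1)"
    and z: "Im z \<ge> 0"
  shows "norm (k z) \<le> 1"
proof -
  have est: "norm (k z) \<le> exp (18432 * \<epsilon> * Im z)" if \<epsilon>: "\<epsilon> > 0" for \<epsilon>
  proof -
    obtain z1 where z1: "Im z1 > 0" "norm (F z1) \<ge> exp (- \<epsilon> * Im z1)" using type[OF \<epsilon>] by blast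
    have ev: "norm (k z) \<le> exp (1152 * \<epsilon> * (16 * Im z + 64 * (norm z)\<^sup>2 / R))"
      if R: "R > 0" "2 * (norm z1)\<^sup>2 \<le> R * Im z1" "8 * norm z \<le> R" for R
    proof -
      have b1: "norm (k w) \<le> exp (12 * \<epsilon> * R\<^sup>2 / Im w)"
        if "0 < Im w" "Im w \<le> R / 4" "\<bar>Re w\<bar> \<le> R / 4" for w
        using half_plane_bound_inverse_height[OF F k F1 kF z1(1) \<epsilon> z1(2) R(1,2) that] by simp
      have b2: "norm (k w) \<le> exp (1152 * \<epsilon> * R)"
        if w: "0 \<le> Im w" "Im w \<le> R / 8" "\<bar>Re w\<bar> \<le> R / 8" for w
      proof -
        have "norm (k w) \<le> exp (24 * (12 * \<epsilon> * R\<^sup>2) / (R / 4))"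
          using w R(1) \<epsilon> b1 real by (intro box_bound_from_inverse_height[OF k]) auto
        thus ?thesis using R(1) by (simp add: power2_eq_square mult.assoc)
      qed
      have zR: "\<bar>Re z\<bar> \<le> R / 8" "Im z \<le> R / 8"
        using abs_Re_le_cmod[of z] abs_Im_le_cmod[of z] R(3) by auto
      have "norm (k z) \<le> exp (1152 * \<epsilon> * R * (2 * Im z / (R / 8) + ((Re z)\<^sup>2 - (Im z)\<^sup>2) / (R / 8)\<^sup>2))"
        using R(1) \<epsilon> real b2 z zR by (intro box_bound_linear_in_height[OF k]) auto
      also have "\<dots> \<le> exp (1152 * \<epsilon> * R * (2 * Im z / (R / 8) + (norm z)\<^sup>2 / (R / 8)\<^sup>2))"
        unfolding exp_le_cancel_iff using \<epsilon> R(1)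
        by (intro mult_left_mono add_left_mono divide_right_mono) (auto simp: cmod_power2)
      also have "1152 * \<epsilon> * R * (2 * Im z / (R / 8) + (norm z)\<^sup>2 / (R / 8)\<^sup>2) =
          1152 * \<epsilon> * (16 * Im z + 64 * (norm z)\<^sup>2 / R)"
        using R(1) by (simp add: field_simps power2_eq_square)
      finally show ?thesis .
    qed
    have "((\<lambda>R. exp (1152 * \<epsilon> * (16 * Im z + 64 * (norm z)\<^sup>2 / R))) \<longlongrightarrow> exp (1152 * \<epsilon> * (16 * Im z + 0))) at_top"
      by (intro tendsto_intros tendsto_divide_0[OF tendsto_const] filterlim_mono[OF filterlim_ident])
         (auto simp: at_top_le_at_infinity)
    moreover have "eventually (\<lambda>R. norm (k z) \<le> exp (1152 * \<epsilon> * (16 * Im z + 64 * (norm z)\<^sup>2 / R))) at_top"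
      using eventually_ge_at_top[of "max 1 (max (2 * (norm z1)\<^sup>2 / Im z1) (8 * norm z))"]
    proof eventually_elim
      case (elim R)
      thus ?case using z1(1) by (intro ev) (auto simp: field_simps)
    qed
    ultimately have "norm (k z) \<le> exp (1152 * \<epsilon> * (16 * Im z + 0))"
      by (rule tendsto_lowerbound) simp
    thus ?thesis by (simp add: mult.assoc)
  qed
  have "((\<lambda>\<epsilon>. exp (18432 * \<epsilon> * Im z)) \<longlongrightarrow> exp (18432 * 0 * Im z)) (at_right 0)"
    by (intro tendsto_intros)
  moreover have "eventually (\<lambda>\<epsilon>. norm (k z) \<le> exp (18432 * \<epsilon> * Im z)) (at_right 0)"
    using eventually_at_right_less by (rule eventually_mono) (rule est)
  ultimately have "norm (k z) \<le> exp (18432 * 0 * Im z)"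
    by (rule tendsto_lowerbound) simp
  thus ?thesis by simp
qed

section \<open>Fourier inversion and growth of Bernstein functions\<close>

lemma entire_eq_if_eq_on_reals:
  assumes hol: "F holomorphic_on UNIV" "G holomorphic_on UNIV"
    and eq: "\<And>x::real. F (of_real x) = G (of_real x)"
  shows "F z = G z"
proof -
  have "F z - G z = 0"
  proof (rule analytic_continuation[where f = "\<lambda>z. F z - G z" and U = \<real> and S = UNIV and \<xi> = 0])
    show "(\<lambda>z. F z - G z) holomorphic_on UNIV" by (intro holomorphic_intros hol)
    show "0 islimpt (\<real> :: complex set)"
      unfolding islimpt_approachable
    proof (intro allI impI)
      fix e :: real assume "e > 0"
      thus "\<exists>x'\<in>\<real>. x' \<noteq> (0::complex) \<and> dist x' 0 < e"
        by (intro bexI[of _ "of_real (e / 2)"]) auto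
    qed
  qed (auto simp: eq elim!: Reals_cases)
  thus ?thesis by simp
qed

lemma normal_density_inverse:
  assumes "m > 0"
  shows "normal_density x (1 / m) t = m / sqrt (2 * pi) * exp (- (m * (t - x))\<^sup>2 / 2)"
proof -
  have "sqrt (2 * pi * (1 / m)\<^sup>2) = sqrt (2 * pi) / m"
    using assms by (simp add: real_sqrt_mult real_sqrt_divide power_divide)
  moreover have "(t - x)\<^sup>2 / (2 * (1 / m)\<^sup>2) = (m * (t - x))\<^sup>2 / 2"
    using assms by (simp add: power_mult_distrib power_divide)
  ultimately show ?thesis unfolding normal_density_def by simp
qed

text \<open>\<open>\<phi>\<close> need not be bounded, so no single dominating function fits both
  regimes. The part \<open>\<psi>\<close> on [x - 1, x + 1] is bounded by compactness and is treated
  after rescaling to the standard normal density. The rest \<open>\<eta>\<close> lives where all the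
  densities are at most 1, so the integrable function |\<phi>| dominates.\<close>

lemma gaussian_approximate_identity:
  fixes \<phi> :: "real \<Rightarrow> complex"
  assumes int: "integrable lborel \<phi>" and cont: "continuous_on UNIV \<phi>"
  shows "(\<lambda>n. LINT t|lborel. of_real (normal_density x (1 / real (Suc n)) t) * \<phi> t) \<longlonglongrightarrow> \<phi> x"
proof -
  define S where "S = {x - 1..x + 1}"
  define N where "N n t = normal_density x (1 / real (Suc n)) t" for n t
  have [measurable]: "\<phi> \<in> borel_measurable borel" using cont by (rule borel_measurable_continuous_onI)
  have [measurable]: "N n \<in> borel_measurable borel" for n unfolding N_def[abs_def] by measurable
  have [measurable]: "S \<in> sets borel" by (simp add: S_def)
  have N: "N n t = real (Suc n) / sqrt (2 * pi) * exp (- (real (Suc n) * (t - x))\<^sup>2 / 2)" for n t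
    unfolding N_def by (rule normal_density_inverse) simp
  have N0: "N n t \<ge> 0" for n t by (simp add: N_def)
  have s2: "sqrt (2 * pi) \<ge> 1" using pi_ge_two by (simp add: real_le_rsqrt)
  obtain K where K: "\<And>t. t \<in> S \<Longrightarrow> norm (\<phi> t) \<le> K"
  proof -
    have "compact (\<phi> ` S)" unfolding S_def
      by (intro compact_continuous_image continuous_on_subset[OF cont]) auto
    thus ?thesis using that by (force dest!: compact_imp_bounded simp: bounded_iff)
  qed
  have K0: "K \<ge> 0" using order_trans[OF norm_ge_zero K[of x]] by (simp add: S_def)
  define \<psi> where "\<psi> t = indicator S t *\<^sub>R \<phi> t" for t
  define \<eta> where "\<eta> t = \<phi> t - \<psi> t" for t
  have [measurable]: "\<psi> \<in> borel_measurable borel" "\<eta> \<in> borel_measurable borel"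
    unfolding \<psi>_def[abs_def] \<eta>_def[abs_def] by measurable
  have \<psi>K: "norm (\<psi> t) \<le> K" for t using K[of t] K0 by (auto simp: \<psi>_def indicator_def)
  have \<eta>le: "norm (\<eta> t) \<le> norm (\<phi> t)" for t by (auto simp: \<eta>_def \<psi>_def indicator_def)
  have Nout: "N n t \<le> 1" if "t \<notin> S" for n t
  proof -
    define m where "m = real (Suc n)"
    have m: "m \<ge> 1" by (simp add: m_def)
    have "1 \<le> \<bar>t - x\<bar>" using that by (auto simp: S_def)
    hence "m \<le> m * \<bar>t - x\<bar>" using m by simp
    hence "m\<^sup>2 \<le> (m * (t - x))\<^sup>2"
      using m by (subst abs_le_square_iff[symmetric]) (simp add: abs_mult)
    hence "exp (- (m * (t - x))\<^sup>2 / 2) \<le> exp (- (m\<^sup>2 / 2))" by simp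
    moreover have "m * exp (- (m\<^sup>2 / 2)) \<le> 1"
    proof -
      have "m \<le> 1 + m\<^sup>2 / 2" using sum_squares_bound[of m 1] by (simp add: power2_eq_square)
      also have "\<dots> \<le> exp (m\<^sup>2 / 2)" by (rule exp_ge_add_one_self)
      finally show ?thesis by (simp add: exp_minus field_simps)
    qed
    ultimately have "m * exp (- (m * (t - x))\<^sup>2 / 2) \<le> 1"
      using m by (meson mult_left_mono order_trans zero_le_one)
    hence "m * exp (- (m * (t - x))\<^sup>2 / 2) \<le> sqrt (2 * pi)" using s2 by linarith
    hence "m * exp (- (m * (t - x))\<^sup>2 / 2) / sqrt (2 * pi) \<le> 1" by (simp add: divide_le_eq)
    thus ?thesis unfolding N m_def by simp
  qed
  have N\<eta>: "norm (of_real (N n t) * \<eta> t) \<le> norm (\<phi> t)" for n t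
  proof (cases "t \<in> S")
    case True thus ?thesis by (simp add: \<eta>_def \<psi>_def)
  next
    case False
    have "N n t * norm (\<eta> t) \<le> 1 * norm (\<phi> t)"
      using Nout[OF False, of n] \<eta>le[of t] by (intro mult_mono) auto
    thus ?thesis using N0[of n t] by (simp add: norm_mult)
  qed
  have lim1: "(\<lambda>n. LINT t|lborel. of_real (N n t) * \<psi> t) \<longlonglongrightarrow> \<phi> x"
  proof -
    have eq: "(LINT t|lborel. of_real (N n t) * \<psi> t) =
      (LINT s|lborel. of_real (std_normal_density s) * \<psi> (x + s / real (Suc n)))" for n
    proof -
      have Ns: "N n (x + s / real (Suc n)) = real (Suc n) * std_normal_density s" for s
        by (simp add: N std_normal_density_def del: of_nat_Suc)
      have "(LINT t|lborel. of_real (N n t) * \<psi> t) = \<bar>1 / real (Suc n)\<bar> *\<^sub>R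
          (LINT s|lborel. of_real (N n (x + 1 / real (Suc n) * s)) * \<psi> (x + 1 / real (Suc n) * s))"
        by (rule lborel_integral_real_affine) simp
      also have "\<dots> = (LINT s|lborel. (1 / real (Suc n)) *\<^sub>R
          (of_real (N n (x + s / real (Suc n))) * \<psi> (x + s / real (Suc n))))"
        by simp
      also have "\<dots> = (LINT s|lborel. of_real (std_normal_density s) * \<psi> (x + s / real (Suc n)))"
        unfolding Ns by (intro Bochner_Integration.integral_cong)
          (auto simp: scaleR_conv_of_real field_simps simp del: of_nat_Suc)
      finally show ?thesis .
    qed
    have "(\<lambda>n. LINT s|lborel. of_real (std_normal_density s) * \<psi> (x + s / real (Suc n)))
       \<longlonglongrightarrow> (LINT s|lborel. of_real (std_normal_density s) * \<phi> x)"
    proof (rule integral_dominated_convergence)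
      show "integrable lborel (\<lambda>s. std_normal_density s * K)" by (intro integrable_mult_left) simp
      show "AE s in lborel. (\<lambda>n. of_real (std_normal_density s) * \<psi> (x + s / real (Suc n)))
          \<longlonglongrightarrow> of_real (std_normal_density s) * \<phi> x"
      proof (intro AE_I2 tendsto_mult tendsto_const)
        fix s :: real
        have l: "(\<lambda>n. x + s / real (Suc n)) \<longlonglongrightarrow> x + 0"
          by (intro tendsto_intros tendsto_divide_0[OF tendsto_const] filterlim_at_top_imp_at_infinity
              filterlim_compose[OF filterlim_real_sequentially filterlim_Suc])
        have "isCont \<phi> x" using cont by (simp add: continuous_on_eq_continuous_at)
        hence "(\<lambda>n. \<phi> (x + s / real (Suc n))) \<longlonglongrightarrow> \<phi> x"
          using l by (intro isCont_tendsto_compose[of x \<phi>]) simp_all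
        moreover have "eventually (\<lambda>n. x + s / real (Suc n) \<in> {x - 1<..<x + 1}) sequentially"
          by (rule topological_tendstoD[OF l]) auto
        hence "eventually (\<lambda>n. \<phi> (x + s / real (Suc n)) = \<psi> (x + s / real (Suc n))) sequentially"
          by eventually_elim (auto simp: \<psi>_def S_def)
        ultimately show "(\<lambda>n. \<psi> (x + s / real (Suc n))) \<longlonglongrightarrow> \<phi> x"
          by (rule Lim_transform_eventually)
      qed
      show "AE s in lborel. norm (of_real (std_normal_density s) * \<psi> (x + s / real (Suc n)))
          \<le> std_normal_density s * K" for n
        using \<psi>K by (auto simp: norm_mult intro!: mult_left_mono)
    qed auto
    also have "(LINT s|lborel. of_real (std_normal_density s) * \<phi> x) = \<phi> x"
      by (simp add: integral_complex_of_real)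
    finally show ?thesis unfolding eq .
  qed
  have lim2: "(\<lambda>n. LINT t|lborel. of_real (N n t) * \<eta> t) \<longlonglongrightarrow> (LINT t::real|lborel. (0::complex))"
  proof (rule integral_dominated_convergence)
    show "integrable lborel (\<lambda>t. norm (\<phi> t))" using int by simp
    show "AE t in lborel. (\<lambda>n. of_real (N n t) * \<eta> t) \<longlonglongrightarrow> 0"
    proof (rule AE_I2)
      fix t
      show "(\<lambda>n. of_real (N n t) * \<eta> t) \<longlonglongrightarrow> 0"
      proof (cases "t \<in> S")
        case True thus ?thesis by (simp add: \<eta>_def \<psi>_def)
      next
        case False
        hence "t - x \<noteq> 0" by (auto simp: S_def)
        define a where "a = (t - x)\<^sup>2 / 2"
        have a: "a > 0" using \<open>t - x \<noteq> 0\<close> by (simp add: a_def)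
        have "N n t \<le> (1 / a) * inverse (real (Suc n))" for n
        proof -
          define m where "m = real (Suc n)"
          have m: "m \<ge> 1" by (simp add: m_def)
          have "a * m\<^sup>2 \<le> exp (a * m\<^sup>2)" using exp_ge_add_one_self[of "a * m\<^sup>2"] by linarith
          hence "m * exp (- (a * m\<^sup>2)) \<le> 1 / (a * m)"
            using a m by (simp add: exp_minus field_simps power2_eq_square)
          moreover have "m * exp (- (a * m\<^sup>2)) / sqrt (2 * pi) \<le> m * exp (- (a * m\<^sup>2))"
            using s2 m by (simp add: divide_le_eq)
          moreover have "N n t = m * exp (- (a * m\<^sup>2)) / sqrt (2 * pi)"
            by (simp add: N m_def a_def power_mult_distrib mult.commute del: of_nat_Suc)
          ultimately have "N n t \<le> 1 / (a * m)" by linarith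
          also have "1 / (a * m) = (1 / a) * inverse m" by (simp add: divide_inverse)
          finally show ?thesis by (simp only: m_def)
        qed
        hence upper: "eventually (\<lambda>n. N n t \<le> (1 / a) * inverse (real (Suc n))) sequentially" by simp
        have lower: "eventually (\<lambda>n. 0 \<le> N n t) sequentially" using N0 by simp
        have "(\<lambda>n. (1 / a) * inverse (real (Suc n))) \<longlonglongrightarrow> (1 / a) * 0"
          by (rule tendsto_mult[OF tendsto_const LIMSEQ_inverse_real_of_nat])
        hence "(\<lambda>n. (1 / a) * inverse (real (Suc n))) \<longlonglongrightarrow> 0" by simp
        hence "(\<lambda>n. N n t) \<longlonglongrightarrow> 0" by (rule tendsto_sandwich[OF lower upper tendsto_const])
        hence "(\<lambda>n. complex_of_real (N n t) * \<eta> t) \<longlonglongrightarrow> complex_of_real 0 * \<eta> t"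
          by (intro tendsto_intros)
        thus ?thesis by simp
      qed
    qed
    show "AE t in lborel. norm (of_real (N n t) * \<eta> t) \<le> norm (\<phi> t)" for n
      using N\<eta> by simp
  qed auto
  have i1: "integrable lborel (\<lambda>t. of_real (N n t) * \<psi> t)" for n
  proof (rule Bochner_Integration.integrable_bound)
    show "integrable lborel (\<lambda>t. N n t * K)" unfolding N_def by (intro integrable_mult_left) simp
    show "AE t in lborel. norm (of_real (N n t) * \<psi> t) \<le> norm (N n t * K)"
      using \<psi>K N0 K0 by (auto simp: norm_mult abs_mult intro!: mult_left_mono)
  qed measurable
  have i2: "integrable lborel (\<lambda>t. of_real (N n t) * \<eta> t)" for n
  proof (rule Bochner_Integration.integrable_bound[OF int])
    show "AE t in lborel. norm (of_real (N n t) * \<eta> t) \<le> norm (\<phi> t)"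
      using N\<eta> by simp
  qed measurable
  have "(LINT t|lborel. of_real (N n t) * \<phi> t) =
     (LINT t|lborel. of_real (N n t) * \<psi> t) + (LINT t|lborel. of_real (N n t) * \<eta> t)" for n
    by (subst Bochner_Integration.integral_add[OF i1 i2, symmetric]) (simp add: \<eta>_def algebra_simps)
  hence "(\<lambda>n. LINT t|lborel. of_real (N n t) * \<phi> t) \<longlonglongrightarrow> \<phi> x + 0"
    using tendsto_add[OF lim1 lim2] by simp
  thus ?thesis by (simp add: N_def)
qed

text \<open>Up to scaling, a Gaussian is its own Fourier transform; after a change of variable this
  is the characteristic function of the standard normal distribution.\<close>

lemma integral_gaussian_cis:
  assumes m: "m > 0"
  shows "(LINT \<xi>|lborel. of_real (std_normal_density (\<xi> / m)) * cis (\<xi> * s)) =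
    of_real (sqrt (2 * pi) * normal_density 0 (1 / m) s)"
proof -
  have "(LINT \<xi>|lborel. of_real (std_normal_density (\<xi> / m)) * cis (\<xi> * s)) =
      \<bar>m\<bar> *\<^sub>R (LINT \<xi>|lborel. of_real (std_normal_density ((0 + m * \<xi>) / m)) * cis ((0 + m * \<xi>) * s))"
    using m by (intro lborel_integral_real_affine) auto
  also have "(LINT \<xi>|lborel. of_real (std_normal_density ((0 + m * \<xi>) / m)) * cis ((0 + m * \<xi>) * s)) =
     (LINT \<xi>|lborel. std_normal_density \<xi> *\<^sub>R iexp (m * s * \<xi>))"
    using m by (intro Bochner_Integration.integral_cong) (auto simp: cis_conv_exp scaleR_conv_of_real mult_ac)
  also have "\<dots> = char std_normal_distribution (m * s)"
    unfolding char_def by (subst integral_density) (auto simp: mult_ac)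
  also have "\<dots> = of_real (exp (- ((m * s)\<^sup>2) / 2))" by (simp add: char_std_normal_distribution)
  also have "\<bar>m\<bar> *\<^sub>R (of_real (exp (- ((m * s)\<^sup>2) / 2)) :: complex) =
      of_real (sqrt (2 * pi) * normal_density 0 (1 / m) s)"
    using m by (simp add: normal_density_inverse scaleR_conv_of_real)
  finally show ?thesis .
qed

lemma continuous_on_fourier_transform:
  fixes \<phi> :: "real \<Rightarrow> complex"
  assumes int: "integrable lborel \<phi>"
  shows "continuous_on UNIV (\<lambda>\<xi>. LINT t|lborel. \<phi> t * cis (- (\<xi> * t)))"
proof -
  have [measurable]: "\<phi> \<in> borel_measurable borel" using int by (simp add: borel_measurable_integrable)
  have [measurable]: "(\<lambda>t. cis (- (a * t))) \<in> borel_measurable borel" for a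
    by (intro borel_measurable_continuous_onI continuous_intros)
  show ?thesis unfolding continuous_on_eq_continuous_at[OF open_UNIV]
  proof (intro ballI, subst continuous_at_sequentially, intro allI impI)
    fix \<xi> :: real and u :: "nat \<Rightarrow> real" assume u: "u \<longlonglongrightarrow> \<xi>"
    have "(\<lambda>n. LINT t|lborel. \<phi> t * cis (- (u n * t))) \<longlonglongrightarrow> (LINT t|lborel. \<phi> t * cis (- (\<xi> * t)))"
    proof (rule integral_dominated_convergence)
      show "integrable lborel (\<lambda>t. norm (\<phi> t))" using int by simp
      show "AE t in lborel. (\<lambda>n. \<phi> t * cis (- (u n * t))) \<longlonglongrightarrow> \<phi> t * cis (- (\<xi> * t))"
        by (intro AE_I2 tendsto_intros tendsto_cis u) 
    qed (auto simp: norm_mult)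
    thus "((\<lambda>\<xi>. LINT t|lborel. \<phi> t * cis (- (\<xi> * t))) \<circ> u) \<longlonglongrightarrow> (LINT t|lborel. \<phi> t * cis (- (\<xi> * t)))"
      by (simp add: o_def)
  qed
qed

text \<open>Without a cutoff the double integral does not converge absolutely. The Gaussian cutoff
  \<open>g n\<close> permits Fubini, and its transform is the normal density at scale 1 / (n + 1)
  around \<open>x\<close>. As n grows the cutoff disappears on one side by dominated convergence,
  and the density concentrates at \<open>x\<close> on the other.\<close>

lemma fourier_inversion:
  fixes \<phi> :: "real \<Rightarrow> complex"
  assumes int: "integrable lborel \<phi>" and cont: "continuous_on UNIV \<phi>"
  defines "\<Phi> \<equiv> \<lambda>\<xi>. LINT t|lborel. \<phi> t * cis (- (\<xi> * t))"
  assumes int': "integrable lborel \<Phi>"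
  shows "(LINT \<xi>|lborel. \<Phi> \<xi> * cis (\<xi> * x)) = 2 * pi * \<phi> x"
proof -
  have [measurable]: "\<phi> \<in> borel_measurable borel" using cont by (rule borel_measurable_continuous_onI)
  have [measurable]: "\<Phi> \<in> borel_measurable borel" using int' by (simp add: borel_measurable_integrable)
  have [measurable]: "cis \<in> borel_measurable borel"
    by (intro borel_measurable_continuous_onI continuous_intros)
  define g where "g n \<xi> = std_normal_density (\<xi> / real (Suc n))" for n \<xi>
  have [measurable]: "g n \<in> borel_measurable borel" for n unfolding g_def[abs_def] by measurable
  have g0: "g n \<xi> \<ge> 0" for n \<xi> by (simp add: g_def)
  have gint: "integrable lborel (g n)" for n
    using lborel_integrable_real_affine[of std_normal_density "1 / real (Suc n)" 0]
    by (simp add: g_def[abs_def])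
  have fub: "(LINT \<xi>|lborel. of_real (g n \<xi>) * (\<Phi> \<xi> * cis (\<xi> * x))) =
      sqrt (2 * pi) * (LINT t|lborel. of_real (normal_density x (1 / real (Suc n)) t) * \<phi> t)" for n
  proof -
    define k where "k t \<xi> = \<phi> t * (of_real (g n \<xi>) * cis (\<xi> * (x - t)))" for t \<xi>
    have [measurable]: "case_prod k \<in> borel_measurable (lborel \<Otimes>\<^sub>M lborel)"
      unfolding k_def[abs_def] by measurable
    have nk: "norm (k t \<xi>) = norm (\<phi> t) * g n \<xi>" for t \<xi> using g0 by (simp add: k_def norm_mult)
    have ik: "integrable (lborel \<Otimes>\<^sub>M lborel) (case_prod k)"
    proof (rule lborel_pair.Fubini_integrable)
      show "integrable lborel (\<lambda>t. LINT \<xi>|lborel. norm (case_prod k (t, \<xi>)))"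
        using int by (simp add: nk)
      show "AE t in lborel. integrable lborel (\<lambda>\<xi>. case_prod k (t, \<xi>))"
      proof (intro AE_I2)
        fix t
        show "integrable lborel (\<lambda>\<xi>. case_prod k (t, \<xi>))"
        proof (rule Bochner_Integration.integrable_bound)
          show "integrable lborel (\<lambda>\<xi>. norm (\<phi> t) * g n \<xi>)" using gint by simp
          show "AE \<xi> in lborel. norm (case_prod k (t, \<xi>)) \<le> norm (norm (\<phi> t) * g n \<xi>)"
            using g0 by (auto simp: nk)
        qed (simp add: k_def)
      qed
    qed simp
    have "(LINT \<xi>|lborel. of_real (g n \<xi>) * (\<Phi> \<xi> * cis (\<xi> * x))) = (LINT \<xi>|lborel. LINT t|lborel. k t \<xi>)"
    proof (intro Bochner_Integration.integral_cong refl)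
      fix \<xi>
      have "of_real (g n \<xi>) * (\<Phi> \<xi> * cis (\<xi> * x)) =
          (LINT t|lborel. \<phi> t * cis (- (\<xi> * t))) * (of_real (g n \<xi>) * cis (\<xi> * x))"
        by (simp add: \<Phi>_def mult_ac)
      also have "\<dots> = (LINT t|lborel. \<phi> t * cis (- (\<xi> * t)) * (of_real (g n \<xi>) * cis (\<xi> * x)))"
        by simp
      also have "\<dots> = (LINT t|lborel. k t \<xi>)"
      proof (intro Bochner_Integration.integral_cong refl)
        fix t
        have "cis (\<xi> * (x - t)) = cis (- (\<xi> * t)) * cis (\<xi> * x)" by (simp add: cis_mult algebra_simps)
        thus "\<phi> t * cis (- (\<xi> * t)) * (of_real (g n \<xi>) * cis (\<xi> * x)) = k t \<xi>" by (simp add: k_def mult_ac)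
      qed
      finally show "of_real (g n \<xi>) * (\<Phi> \<xi> * cis (\<xi> * x)) = (LINT t|lborel. k t \<xi>)" .
    qed
    also have "\<dots> = (LINT t|lborel. LINT \<xi>|lborel. k t \<xi>)"
      by (rule lborel_pair.Fubini_integral[OF ik])
    also have "\<dots> = (LINT t|lborel. sqrt (2 * pi) * (of_real (normal_density x (1 / real (Suc n)) t) * \<phi> t))"
    proof (intro Bochner_Integration.integral_cong refl)
      fix t
      have nd: "normal_density 0 (1 / real (Suc n)) (x - t) = normal_density x (1 / real (Suc n)) t"
        by (simp add: normal_density_def power2_commute)
      show "(LINT \<xi>|lborel. k t \<xi>) = sqrt (2 * pi) * (of_real (normal_density x (1 / real (Suc n)) t) * \<phi> t)"
        unfolding k_def g_def by (simp add: integral_gaussian_cis nd del: of_nat_Suc)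
    qed
    also have "\<dots> = sqrt (2 * pi) * (LINT t|lborel. of_real (normal_density x (1 / real (Suc n)) t) * \<phi> t)"
      by simp
    finally show ?thesis .
  qed
  have "(\<lambda>n. LINT \<xi>|lborel. of_real (g n \<xi>) * (\<Phi> \<xi> * cis (\<xi> * x)))
      \<longlonglongrightarrow> (LINT \<xi>|lborel. of_real (std_normal_density 0) * (\<Phi> \<xi> * cis (\<xi> * x)))"
  proof (rule integral_dominated_convergence)
    show "integrable lborel (\<lambda>\<xi>. norm (\<Phi> \<xi>))" using int' by simp
    show "AE \<xi> in lborel. (\<lambda>n. of_real (g n \<xi>) * (\<Phi> \<xi> * cis (\<xi> * x)))
        \<longlonglongrightarrow> of_real (std_normal_density 0) * (\<Phi> \<xi> * cis (\<xi> * x))"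
    proof (intro AE_I2 tendsto_mult tendsto_const tendsto_of_real)
      fix \<xi> :: real
      have l: "(\<lambda>n. \<xi> / real (Suc n)) \<longlonglongrightarrow> 0"
        by (intro tendsto_divide_0[OF tendsto_const] filterlim_at_top_imp_at_infinity
            filterlim_compose[OF filterlim_real_sequentially filterlim_Suc])
      show "(\<lambda>n. g n \<xi>) \<longlonglongrightarrow> std_normal_density 0"
        unfolding g_def std_normal_density_def using l by (intro tendsto_intros) auto
    qed
    have "g n \<xi> \<le> 1" for n \<xi>
    proof -
      have "sqrt (2 * pi) \<ge> 1" using pi_ge_two by (simp add: real_le_rsqrt)
      moreover have "exp (- (\<xi> / real (Suc n))\<^sup>2 / 2) \<le> 1" by simp
      ultimately have "exp (- (\<xi> / real (Suc n))\<^sup>2 / 2) \<le> sqrt (2 * pi)" by (rule order_trans[rotated])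
      thus ?thesis unfolding g_def std_normal_density_def by (simp add: divide_le_eq)
    qed
    thus "AE \<xi> in lborel. norm (of_real (g n \<xi>) * (\<Phi> \<xi> * cis (\<xi> * x))) \<le> norm (\<Phi> \<xi>)" for n
      using g0 by (auto simp: norm_mult intro!: mult_left_le_one_le)
  qed auto
  moreover have "(\<lambda>n. LINT \<xi>|lborel. of_real (g n \<xi>) * (\<Phi> \<xi> * cis (\<xi> * x))) \<longlonglongrightarrow> sqrt (2 * pi) * \<phi> x"
    unfolding fub by (intro tendsto_intros gaussian_approximate_identity int cont)
  \<comment> \<open>The limit of the cutoff is its value 1 / sqrt (2 pi) at 0, not 1; moved to the
    right it completes the factor 2 pi.\<close>
  ultimately have "of_real (std_normal_density 0) * (LINT \<xi>|lborel. \<Phi> \<xi> * cis (\<xi> * x)) = sqrt (2 * pi) * \<phi> x"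
    by (subst integral_mult_right_zero[symmetric]) (rule LIMSEQ_unique)
  hence "(LINT \<xi>|lborel. \<Phi> \<xi> * cis (\<xi> * x)) =
      complex_of_real (sqrt (2 * pi)) * complex_of_real (sqrt (2 * pi)) * \<phi> x"
    unfolding std_normal_density_def by (simp add: divide_eq_eq mult_ac)
  also have "complex_of_real (sqrt (2 * pi)) * complex_of_real (sqrt (2 * pi)) = of_real (2 * pi)"
    by (simp only: of_real_mult[symmetric]) simp
  finally show ?thesis by simp
qed

text \<open>Membership in \<open>Bernstein1\<close> gives no growth off the real line directly. The
  transform is continuous and vanishes outside [-\<sigma>, \<sigma>], hence is bounded and
  integrable, so inversion applies. The inversion integral over this interval makes sense for
  complex z, agrees with \<open>F\<close> by the identity theorem, and can be estimated under the
  integral sign.\<close>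

lemma Bernstein1_growth:
  assumes F: "F \<in> Bernstein1 \<sigma>" and \<sigma>: "0 < \<sigma>"
  obtains C where "C > 0" "\<And>z. norm (F z) \<le> C * exp (\<sigma> * \<bar>Im z\<bar>)"
proof -
  define \<phi> where "\<phi> t = F (of_real t)" for t :: real
  define \<Phi> where "\<Phi> = (\<lambda>\<xi>. LINT t|lborel. \<phi> t * cis (- (\<xi> * t)))"
  have hol: "F holomorphic_on UNIV" and int: "integrable lborel \<phi>"
    and supp: "\<And>\<xi>. \<bar>\<xi>\<bar> > \<sigma> \<Longrightarrow> \<Phi> \<xi> = 0"
    using F by (auto simp: Bernstein1_def \<phi>_def[abs_def] \<Phi>_def fourier_real_def)
  have cont: "continuous_on UNIV \<phi>" unfolding \<phi>_def
    by (rule continuous_on_compose2[OF holomorphic_on_imp_continuous_on[OF hol]])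
       (auto intro!: continuous_intros)
  have cont\<Phi>: "continuous_on UNIV \<Phi>"
    unfolding \<Phi>_def by (rule continuous_on_fourier_transform[OF int])
  have cont\<Phi>': "continuous_on A \<Phi>" for A using cont\<Phi> by (rule continuous_on_subset) simp
  have \<Phi>ind: "\<Phi> \<xi> = indicator {-\<sigma>..\<sigma>} \<xi> *\<^sub>R \<Phi> \<xi>" for \<xi>
    using supp[of \<xi>] by (auto simp: indicator_def abs_if split: if_splits)
  have int': "integrable lborel \<Phi>"
    by (subst \<Phi>ind[abs_def]) (intro borel_integrable_compact cont\<Phi>' compact_Icc)
  define E where "E z = integral (cbox (-\<sigma>) \<sigma>) (\<lambda>\<xi>. \<Phi> \<xi> * exp (\<i> * of_real \<xi> * z))" for z
  have contE: "continuous_on A (\<lambda>\<xi>. \<Phi> \<xi> * exp (\<i> * of_real \<xi> * z))" for A z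
    by (intro continuous_intros cont\<Phi>')
  have holE: "E holomorphic_on UNIV"
    unfolding E_def
  proof (rule leibniz_rule_holomorphic)
    fix z :: complex and \<xi> :: real
    show "((\<lambda>z. \<Phi> \<xi> * exp (\<i> * of_real \<xi> * z)) has_field_derivative
        \<Phi> \<xi> * (exp (\<i> * of_real \<xi> * z) * (\<i> * of_real \<xi>))) (at z within UNIV)"
      by (auto intro!: derivative_eq_intros)
    show "(\<lambda>\<xi>. \<Phi> \<xi> * exp (\<i> * of_real \<xi> * z)) integrable_on cbox (-\<sigma>) \<sigma>"
      by (intro integrable_continuous contE)
    show "continuous_on (UNIV \<times> cbox (-\<sigma>) \<sigma>) (\<lambda>(z, \<xi>). \<Phi> \<xi> * (exp (\<i> * of_real \<xi> * z) * (\<i> * of_real \<xi>)))"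
      unfolding case_prod_beta
      by (intro continuous_intros continuous_on_compose2[OF cont\<Phi>]) auto
  qed auto
  have ER: "E (of_real x) = 2 * pi * F (of_real x)" for x
  proof -
    have "2 * pi * F (of_real x) = (LINT \<xi>|lborel. \<Phi> \<xi> * cis (\<xi> * x))"
      using fourier_inversion[OF int cont int'[unfolded \<Phi>_def]] by (simp add: \<Phi>_def \<phi>_def)
    also have "\<dots> = (LINT \<xi>:{-\<sigma>..\<sigma>}|lborel. \<Phi> \<xi> * exp (\<i> * of_real \<xi> * of_real x))"
      unfolding set_lebesgue_integral_def
    proof (intro Bochner_Integration.integral_cong refl)
      fix \<xi>
      show "\<Phi> \<xi> * cis (\<xi> * x) = indicator {-\<sigma>..\<sigma>} \<xi> *\<^sub>R (\<Phi> \<xi> * exp (\<i> * of_real \<xi> * of_real x))"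
        using supp[of \<xi>] by (auto simp: indicator_def abs_if cis_conv_exp mult_ac split: if_splits)
    qed
    also have "\<dots> = E (of_real x)"
      unfolding E_def cbox_interval
      by (intro set_borel_integral_eq_integral(2))
         (auto simp: set_integrable_def intro!: borel_integrable_compact contE)
    finally show ?thesis by simp
  qed
  have EF: "E z = 2 * pi * F z" for z
    by (rule entire_eq_if_eq_on_reals[OF holE _ ER]) (intro holomorphic_intros hol)
  obtain K where K: "\<And>\<xi>. \<xi> \<in> {-\<sigma>..\<sigma>} \<Longrightarrow> norm (\<Phi> \<xi>) \<le> K"
  proof -
    have "compact (\<Phi> ` {-\<sigma>..\<sigma>})" by (intro compact_continuous_image cont\<Phi>') auto
    thus ?thesis using that by (force dest!: compact_imp_bounded simp: bounded_iff)
  qed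
  have K0: "K \<ge> 0" using order_trans[OF norm_ge_zero K[of 0]] \<sigma> by simp
  have bd: "norm (F z) \<le> (K * (2 * \<sigma>)) / (2 * pi) * exp (\<sigma> * \<bar>Im z\<bar>)" for z
  proof -
    have "norm (E z) \<le> (K * exp (\<sigma> * \<bar>Im z\<bar>)) * (\<sigma> - (- \<sigma>))"
      unfolding E_def cbox_interval
    proof (rule integral_bound)
      fix \<xi> assume \<xi>: "\<xi> \<in> {-\<sigma>..\<sigma>}"
      have "- (\<xi> * Im z) \<le> \<bar>\<xi>\<bar> * \<bar>Im z\<bar>" by (metis abs_ge_minus_self abs_mult)
      also have "\<dots> \<le> \<sigma> * \<bar>Im z\<bar>" using \<xi> by (intro mult_right_mono) auto
      finally have "exp (- (\<xi> * Im z)) \<le> exp (\<sigma> * \<bar>Im z\<bar>)" by simp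
      thus "norm (\<Phi> \<xi> * exp (\<i> * of_real \<xi> * z)) \<le> K * exp (\<sigma> * \<bar>Im z\<bar>)"
        using K[OF \<xi>] K0 by (simp add: norm_mult mult_mono)
    qed (use \<sigma> contE in auto)
    moreover have "norm (E z) = 2 * pi * norm (F z)" by (simp add: EF norm_mult)
    ultimately show ?thesis by (simp add: field_simps)
  qed
  show ?thesis
  proof (rule that)
    show "(K * (2 * \<sigma>)) / (2 * pi) + 1 > 0" using K0 \<sigma> by (intro add_nonneg_pos) auto
    show "norm (F z) \<le> ((K * (2 * \<sigma>)) / (2 * pi) + 1) * exp (\<sigma> * \<bar>Im z\<bar>)" for z
      using bd[of z] by (simp add: distrib_right add_increasing2)
  qed
qed

section \<open>Nonnegative quotients of entire functions\<close>

lemma holomorphic_reflect: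
  "F holomorphic_on UNIV \<Longrightarrow> (\<lambda>z. cnj (F (cnj z))) holomorphic_on UNIV"
  using holomorphic_on_compose_cnj_cnj[of F UNIV] 
  by (simp add: o_def surjI[of cnj cnj])

lemma isCont_entire:
  assumes "F holomorphic_on UNIV"
  shows "isCont F z"
  using holomorphic_on_imp_continuous_on[OF assms] by (simp add: continuous_on_eq_continuous_at)

lemma entire_nonzero_nearby:
  assumes "F holomorphic_on UNIV" "F w \<noteq> 0"
  obtains e where "e > 0" "\<And>z. z \<in> ball w e \<Longrightarrow> F z \<noteq> 0"
  using continuous_at_avoid[OF isCont_entire[OF assms(1)] assms(2)] by auto

lemma entire_isolated_zeros:
  assumes "F holomorphic_on UNIV" "F z0 \<noteq> 0"
  obtains r where "r > 0" "\<And>z. z \<in> ball w r - {w} \<Longrightarrow> F z \<noteq> 0"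
proof (cases "F w = 0")
  case True
  show ?thesis using isolated_zeros[OF assms(1) open_UNIV connected_UNIV UNIV_I True UNIV_I assms(2)] that by metis
next
  case False
  show ?thesis using entire_nonzero_nearby[OF assms(1) False] that by (metis DiffD1)
qed

lemma eventually_at_right_real_punctured_ball:
  assumes "r > 0" "\<And>z. z \<in> ball (of_real x) r - {of_real x} \<Longrightarrow> P z"
  shows "eventually (\<lambda>t. P (of_real (x + t) :: complex)) (at_right 0)"
    and "eventually (\<lambda>t. P (of_real (x - t) :: complex)) (at_right 0)"
proof -
  have "eventually (\<lambda>t. t \<in> {0<..<r}) (at_right (0::real))"
    using assms(1) by (rule eventually_at_right_real)
  moreover have "P (of_real (x + t))" "P (of_real (x - t))" if "t \<in> {0<..<r}" for t
    using that by (auto intro!: assms(2) simp: dist_norm)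
  ultimately show "eventually (\<lambda>t. P (of_real (x + t))) (at_right 0)"
    "eventually (\<lambda>t. P (of_real (x - t))) (at_right 0)"
    by (auto elim!: eventually_mono)
qed

lemma tendsto_along_real:
  fixes F :: "complex \<Rightarrow> complex"
  assumes "isCont F (of_real x)"
  shows "((\<lambda>t. F (of_real (x + t))) \<longlongrightarrow> F (of_real x)) (at_right 0)"
    and "((\<lambda>t. F (of_real (x - t))) \<longlongrightarrow> F (of_real x)) (at_right 0)"
proof -
  have "((\<lambda>t. complex_of_real (x + t)) \<longlongrightarrow> of_real (x + 0)) (at_right 0)"
    "((\<lambda>t. complex_of_real (x - t)) \<longlongrightarrow> of_real (x - 0)) (at_right 0)"
    by (intro tendsto_intros)+
  thus "((\<lambda>t. F (of_real (x + t))) \<longlongrightarrow> F (of_real x)) (at_right 0)"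
    "((\<lambda>t. F (of_real (x - t))) \<longlongrightarrow> F (of_real x)) (at_right 0)"
    using assms by (auto intro: isCont_tendsto_compose)
qed

lemma entire_divide_linear:
  assumes "F holomorphic_on UNIV" "F a = 0"
  obtains F0 where "F0 holomorphic_on UNIV" "F0 a = deriv F a" "\<And>z. F z = (z - a) * F0 z"
proof -
  define F0 where "F0 z = (if z = a then deriv F a else (F z - F a) / (z - a))" for z
  have "F0 holomorphic_on UNIV"
    unfolding F0_def[abs_def] by (rule pole_lemma_open[OF assms(1) open_UNIV])
  thus ?thesis using assms(2) by (intro that[of F0]) (auto simp: F0_def)
qed

text \<open>A positive quotient changes sign at a simple pole on the line, so real zeros of the
  denominator are harmless; a non-real pole would come with its conjugate.\<close>

lemma entire_nonneg_quotient:
  assumes f: "f holomorphic_on UNIV" and g: "g holomorphic_on UNIV" and nz: "f z0 \<noteq> 0"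
    and conj: "no_conjugate_zeros f" and simple: "real_zeros_simple f"
    and nonneg: "\<And>x::real. f (of_real x) \<noteq> 0 \<Longrightarrow> g (of_real x) / f (of_real x) \<in> \<real>\<^sub>\<ge>\<^sub>0"
  obtains h where "h holomorphic_on UNIV" "\<And>z. g z = h z * f z" "\<And>x::real. h (of_real x) \<in> \<real>\<^sub>\<ge>\<^sub>0"
proof -
  define fs where "fs z = cnj (f (cnj z))" for z
  define gs where "gs z = cnj (g (cnj z))" for z
  have fs: "fs holomorphic_on UNIV" and gs: "gs holomorphic_on UNIV"
    unfolding fs_def[abs_def] gs_def[abs_def] by (intro holomorphic_reflect f g)+
  \<comment> \<open>On the real line the quotient is real, so it equals its reflection.
    Cross-multiplied, the identity extends to the plane and lets \<open>gs / fs\<close> replace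
    \<open>g / f\<close> near a non-real zero of \<open>f\<close>, where \<open>fs\<close> does not
    vanish.\<close>
  have sym: "g z * fs z = gs z * f z" for z
  proof (rule entire_eq_if_eq_on_reals[where F = "\<lambda>z. g z * fs z" and G = "\<lambda>z. gs z * f z"])
    fix x :: real
    show "g (of_real x) * fs (of_real x) = gs (of_real x) * f (of_real x)"
    proof (cases "f (of_real x) = 0")
      case True thus ?thesis by (simp add: fs_def)
    next
      case False
      then obtain c where "g (of_real x) / f (of_real x) = of_real c"
        using nonneg[OF False] by (auto elim!: nonneg_Reals_cases)
      hence "g (of_real x) = of_real c * f (of_real x)" using False by (simp add: field_simps)
      thus ?thesis by (simp add: fs_def gs_def)
    qed
  qed (intro holomorphic_intros f g fs gs)+
  have local: "\<exists>e k. e > 0 \<and> k holomorphic_on ball w e \<and> (\<forall>z\<in>ball w e. g z = k z * f z)" for w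
  proof -
    consider "f w \<noteq> 0" | "f w = 0" "Im w \<noteq> 0" | "f w = 0" "Im w = 0" by blast
    thus ?thesis
    proof cases
      case 1
      then obtain e where e: "e > 0" "\<And>z. z \<in> ball w e \<Longrightarrow> f z \<noteq> 0"
        using entire_nonzero_nearby[OF f] by blast
      have "(\<lambda>z. g z / f z) holomorphic_on ball w e"
        using e(2) by (intro holomorphic_intros holomorphic_on_subset[OF f] holomorphic_on_subset[OF g]) auto
      thus ?thesis using e by (intro exI[of _ e] exI[of _ "\<lambda>z. g z / f z"]) simp
    next
      case 2
      have "fs w \<noteq> 0" using conj 2 by (auto simp: no_conjugate_zeros_def fs_def)
      then obtain e where e: "e > 0" "\<And>z. z \<in> ball w e \<Longrightarrow> fs z \<noteq> 0"
        using entire_nonzero_nearby[OF fs] by blast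
      have "(\<lambda>z. gs z / fs z) holomorphic_on ball w e"
        using e(2) by (intro holomorphic_intros holomorphic_on_subset[OF fs] holomorphic_on_subset[OF gs]) auto
      thus ?thesis using e sym by (intro exI[of _ e] exI[of _ "\<lambda>z. gs z / fs z"]) (simp add: field_simps)
    next
      case 3
      define x where "x = Re w"
      have w: "w = of_real x" using 3 by (simp add: x_def complex_eq_iff)
      obtain f0 where f0: "f0 holomorphic_on UNIV" "f0 w = deriv f w" "\<And>z. f z = (z - w) * f0 z"
        using entire_divide_linear[OF f 3(1)] by blast
      have "f (of_real x) = 0" using 3(1) w by simp
      hence "deriv f (of_real x) \<noteq> 0" using simple by (simp add: real_zeros_simple_def)
      hence f0w: "f0 w \<noteq> 0" using f0(2) w by simp
      then obtain e where e: "e > 0" "\<And>z. z \<in> ball w e \<Longrightarrow> f0 z \<noteq> 0"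
        using entire_nonzero_nearby[OF f0(1)] by blast
      \<comment> \<open>At distance t from \<open>x\<close>, \<open>q\<close> is t times the
        quotient on the right and -t times it on the left. The two one-sided limits force
        \<open>q\<close> to vanish at \<open>x\<close>, so \<open>g\<close> supplies the factor that
        cancels the zero of \<open>f\<close>.\<close>
      define q where "q z = g z / f0 z" for z
      have qc: "isCont q (of_real x)"
        unfolding q_def using f0w w by (intro continuous_intros isCont_entire g f0) simp
      have fnz: "f z \<noteq> 0" if "z \<in> ball (of_real x) e - {of_real x}" for z
        using that e(2)[of z] by (auto simp: f0(3) w)
      have pos: "eventually (\<lambda>t. f (of_real (x + t)) \<noteq> 0 \<and> t > 0) (at_right 0)"
        "eventually (\<lambda>t. f (of_real (x - t)) \<noteq> 0 \<and> t > 0) (at_right 0)"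
        by (intro eventually_conj eventually_at_right_real_punctured_ball[OF e(1), where P = "\<lambda>z. f z \<noteq> 0"]
            fnz eventually_at_right_less; assumption)+
      have "q (of_real x) \<in> \<real>\<^sub>\<ge>\<^sub>0"
      proof (rule Lim_in_closed_set[OF closed_nonneg_Reals_complex _ _ tendsto_along_real(1)[OF qc]])
        show "\<forall>\<^sub>F t in at_right 0. q (of_real (x + t)) \<in> \<real>\<^sub>\<ge>\<^sub>0"
          using pos(1)
        proof eventually_elim
          case (elim t)
          have "q (of_real (x + t)) = of_real t * (g (of_real (x + t)) / f (of_real (x + t)))"
            using elim by (simp add: q_def f0(3) w)
          moreover have "of_real t * (g (of_real (x + t)) / f (of_real (x + t))) \<in> \<real>\<^sub>\<ge>\<^sub>0"
            using nonneg[of "x + t"] elim by (intro nonneg_Reals_mult_I) auto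
          ultimately show ?case by (simp only:)
        qed
      qed simp
      moreover have "- q (of_real x) \<in> \<real>\<^sub>\<ge>\<^sub>0"
      proof (rule Lim_in_closed_set[OF closed_nonneg_Reals_complex _ _ tendsto_minus[OF tendsto_along_real(2)[OF qc]]])
        show "\<forall>\<^sub>F t in at_right 0. - q (of_real (x - t)) \<in> \<real>\<^sub>\<ge>\<^sub>0"
          using pos(2)
        proof eventually_elim
          case (elim t)
          have "- q (of_real (x - t)) = of_real t * (g (of_real (x - t)) / f (of_real (x - t)))"
            using elim by (simp add: q_def f0(3) w)
          moreover have "of_real t * (g (of_real (x - t)) / f (of_real (x - t))) \<in> \<real>\<^sub>\<ge>\<^sub>0"
            using nonneg[of "x - t"] elim by (intro nonneg_Reals_mult_I) auto
          ultimately show ?case by (simp only:)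
        qed
      qed simp
      ultimately have "q w = 0" by (simp add: complex_nonneg_Reals_iff w complex_eq_iff)
      hence gw: "g w = 0" using f0w by (simp add: q_def)
      obtain g0 where g0: "g0 holomorphic_on UNIV" "\<And>z. g z = (z - w) * g0 z"
        using entire_divide_linear[OF g gw] by blast
      have "(\<lambda>z. g0 z / f0 z) holomorphic_on ball w e"
        using e(2) by (intro holomorphic_intros holomorphic_on_subset[OF f0(1)] holomorphic_on_subset[OF g0(1)]) auto
      moreover have "g z = g0 z / f0 z * f z" if "z \<in> ball w e" for z
        using e(2)[OF that] by (simp add: f0(3) g0(2))
      ultimately show ?thesis using e(1) by (intro exI[of _ e] exI[of _ "\<lambda>z. g0 z / f0 z"]) blast
    qed
  qed
  then obtain e k where k: "\<And>w. e w > 0" "\<And>w. k w holomorphic_on ball w (e w)"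
    "\<And>w z. z \<in> ball w (e w) \<Longrightarrow> g z = k w z * f z" by metis
  \<comment> \<open>At a zero the value is taken from the local quotient centred there. As zeros are
    isolated, a small ball around \<open>w\<close> meets no other zero, so \<open>h\<close> agrees
    with \<open>k w\<close> on all of it.\<close>
  define h where "h z = (if f z \<noteq> 0 then g z / f z else k z z)" for z
  have "h field_differentiable at w" for w
  proof -
    obtain r where r: "r > 0" "\<And>z. z \<in> ball w r - {w} \<Longrightarrow> f z \<noteq> 0"
      using entire_isolated_zeros[OF f nz] by blast
    have "h z = k w z" if "z \<in> ball w (min r (e w))" for z
    proof (cases "f z = 0")
      case True
      hence "z = w" using r(2)[of z] that by auto
      thus ?thesis using True by (simp add: h_def)
    next
      case False
      thus ?thesis using k(3)[of z w] that by (simp add: h_def)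
    qed
    hence "h holomorphic_on ball w (min r (e w))"
      by (intro holomorphic_transform[OF holomorphic_on_subset[OF k(2)[of w]]]) auto
    thus ?thesis using r(1) k(1)[of w] by (intro holomorphic_on_imp_differentiable_at) auto
  qed
  hence h: "h holomorphic_on UNIV" by (simp add: holomorphic_on_def)
  have ghf: "g z = h z * f z" for z
    using k(1)[of z] k(3)[of z z] by (simp add: h_def)
  have "h (of_real x) \<in> \<real>\<^sub>\<ge>\<^sub>0" for x :: real
  proof -
    obtain r where r: "r > 0" "\<And>z. z \<in> ball (of_real x) r - {of_real x} \<Longrightarrow> f z \<noteq> 0"
      using entire_isolated_zeros[OF f nz] by blast
    have ev: "\<forall>\<^sub>F t in at_right 0. f (of_real (x + t)) \<noteq> 0"
      by (rule eventually_at_right_real_punctured_ball(1)[OF r(1), where P = "\<lambda>z. f z \<noteq> 0"]) (rule r(2))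
    show ?thesis
    proof (rule Lim_in_closed_set[OF closed_nonneg_Reals_complex _ _ tendsto_along_real(1)[OF isCont_entire[OF h]]])
      show "\<forall>\<^sub>F t in at_right 0. h (of_real (x + t)) \<in> \<real>\<^sub>\<ge>\<^sub>0"
        using ev
      proof eventually_elim
        case (elim t)
        thus ?case using nonneg[of "x + t"] by (simp add: h_def)
      qed
    qed simp
  qed
  thus ?thesis using that h ghf by blast
qed

lemma continuous_AE_zero:
  fixes \<phi> :: "real \<Rightarrow> real"
  assumes cont: "continuous_on UNIV \<phi>" and AE: "AE x in lborel. \<phi> x = 0"
  shows "\<phi> x = 0"
proof (rule ccontr)
  assume "\<phi> x \<noteq> 0"
  moreover have "isCont \<phi> x" using cont by (simp add: continuous_on_eq_continuous_at)
  ultimately obtain e where e: "e > 0" "\<And>y. dist x y < e \<Longrightarrow> \<phi> y \<noteq> 0"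
    using continuous_at_avoid by blast
  obtain N where N: "{y \<in> space lborel. \<not> \<phi> y = 0} \<subseteq> N" "emeasure lborel N = 0" "N \<in> sets lborel"
    using AE by (rule AE_E)
  have "{x - e<..<x + e} \<subseteq> N" 
  proof
    fix y assume "y \<in> {x - e<..<x + e}"
    hence "dist x y < e" by (auto simp: dist_real_def)
    thus "y \<in> N" using N(1) e(2) by auto
  qed
  hence "emeasure lborel {x - e<..<x + e} \<le> emeasure lborel N" using N(3) by (rule emeasure_mono)
  thus False using N(2) e(1) by simp
qed

text \<open>The integral of \<open>|G|\<close> over a segment of the line is the value at \<open>\<i>b\<close> of the
  exponential type function \<open>\<Gamma>(z) = \<integral> G(t + z) s(t) dt\<close> with a unimodular weight \<open>s\<close>; on the real line
  \<open>\<Gamma>\<close> is bounded by the \<open>L\<^sup>1\<close> norm, whatever the segment.\<close>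

lemma upper_line_integral_bound:
  assumes hol: "G holomorphic_on UNIV" and int: "integrable lborel (\<lambda>t::real. G (of_real t))"
    and growth: "\<And>z. norm (G z) \<le> C * exp (\<sigma> * \<bar>Im z\<bar>)"
    and b: "b \<ge> 0" and ab: "x0 \<le> x1"
    and nz: "\<And>t. x0 \<le> t \<Longrightarrow> t \<le> x1 \<Longrightarrow> G (Complex t b) \<noteq> 0"
  shows "integral {x0..x1} (\<lambda>t. norm (G (Complex t b))) \<le> exp (\<sigma> * b) * (L1norm G + 1)"
proof -
  \<comment> \<open>The summand 1 keeps the later divisor positive even if the norm is 0.\<close>
  define N where "N = L1norm G + 1"
  have "L1norm G \<ge> 0" unfolding L1norm_def by simp
  hence N: "N > 0" "L1norm G \<le> N" by (auto simp: N_def)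
  have "0 \<le> C * exp (\<sigma> * \<bar>Im 0\<bar>)" by (rule order_trans[OF norm_ge_zero growth])
  hence C: "C \<ge> 0" by simp
  have contG: "continuous_on A (\<lambda>t. G (g t))" if "continuous_on A g" for A :: "'a::topological_space set" and g
    by (rule continuous_on_compose2[OF holomorphic_on_imp_continuous_on[OF hol] that]) simp
  have Cx: "Complex t b = of_real t + \<i> * of_real b" for t by (simp add: complex_eq_iff)
  \<comment> \<open>\<open>s\<close> is the conjugate sign of \<open>G\<close> on the segment;
    \<open>nz\<close> makes it continuous, as differentiation under the integral sign requires
    here.\<close>
  define s where "s t = cnj (G (of_real t + \<i> * of_real b)) / of_real (norm (G (of_real t + \<i> * of_real b)))" for t
  have s1: "norm (s t) \<le> 1" for t by (simp add: s_def norm_divide)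
  have nz': "G (of_real t + \<i> * of_real b) \<noteq> 0" if "t \<in> {x0..x1}" for t
    using nz[of t] that by (simp add: Cx)
  have conts: "continuous_on {x0..x1} s" unfolding s_def
    by (intro continuous_intros contG) (use nz' in auto)
  define \<Gamma> where "\<Gamma> z = integral (cbox x0 x1) (\<lambda>t. G (of_real t + z) * s t)" for z
  have contI: "continuous_on {x0..x1} (\<lambda>t. G (of_real t + z) * s t)" for z
    by (intro continuous_intros contG conts)
  have hol\<Gamma>: "\<Gamma> holomorphic_on UNIV" unfolding \<Gamma>_def
  proof (rule leibniz_rule_holomorphic)
    fix z t
    have "(G has_field_derivative deriv G (of_real t + z)) (at (of_real t + z))"
      using hol by (intro holomorphic_derivI[of _ UNIV]) auto
    hence "((\<lambda>z. G (of_real t + z)) has_field_derivative deriv G (of_real t + z) * 1) (at z)"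
      by (intro DERIV_chain2) (auto intro!: derivative_eq_intros)
    thus "((\<lambda>z. G (of_real t + z) * s t) has_field_derivative deriv G (of_real t + z) * s t) (at z within UNIV)"
      by (auto intro: DERIV_cmult_right)
    show "(\<lambda>t. G (of_real t + z) * s t) integrable_on cbox x0 x1"
      using contI by (intro integrable_continuous) simp
  next
    have "continuous_on UNIV (deriv G)"
      by (intro holomorphic_on_imp_continuous_on holomorphic_deriv hol open_UNIV)
    hence "continuous_on (UNIV \<times> cbox x0 x1) (\<lambda>p. deriv G (of_real (snd p) + fst p))"
      by (rule continuous_on_compose2) (auto intro!: continuous_intros)
    moreover have "continuous_on (UNIV \<times> cbox x0 x1) (\<lambda>p. s (snd p))"
      by (rule continuous_on_compose2[OF conts]) (auto intro!: continuous_intros)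
    ultimately show "continuous_on (UNIV \<times> cbox x0 x1) (\<lambda>(z, t). deriv G (of_real t + z) * s t)"
      unfolding case_prod_beta by (rule continuous_on_mult)
  qed simp
  have real: "norm (\<Gamma> (of_real x)) \<le> N" for x :: real
  proof -
    have ci: "continuous_on {x0..x1} (\<lambda>t. norm (G (of_real (x + t))))"
      by (intro continuous_intros contG)
    have si: "set_integrable lborel {x0..x1} (\<lambda>t. norm (G (of_real (x + t))))"
      unfolding set_integrable_def by (intro borel_integrable_compact compact_Icc ci)
    have il: "integrable lborel (\<lambda>t. norm (G (of_real (x + 1 * t))))"
      using int by (intro integrable_norm lborel_integrable_real_affine[of "\<lambda>t. G (of_real t)"]) auto
    have "norm (\<Gamma> (of_real x)) \<le> integral {x0..x1} (\<lambda>t. norm (G (of_real (x + t))))"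
      unfolding \<Gamma>_def cbox_interval
    proof (rule integral_norm_bound_integral)
      show "(\<lambda>t. G (of_real t + of_real x) * s t) integrable_on {x0..x1}"
        by (intro integrable_continuous_interval contI)
      show "(\<lambda>t. norm (G (of_real (x + t)))) integrable_on {x0..x1}"
        by (intro integrable_continuous_interval ci)
      show "norm (G (of_real t + of_real x) * s t) \<le> norm (G (of_real (x + t)))" for t
        using s1[of t] by (simp add: norm_mult add.commute mult_left_le)
    qed
    also have "\<dots> = (LINT t:{x0..x1}|lborel. norm (G (of_real (x + t))))"
      by (rule set_borel_integral_eq_integral(2)[OF si, symmetric])
    also have "\<dots> \<le> (LINT t|lborel. norm (G (of_real (x + 1 * t))))"
      unfolding set_lebesgue_integral_def
    proof (rule integral_mono)
      show "integrable lborel (\<lambda>t. indicat_real {x0..x1} t *\<^sub>R norm (G (of_real (x + t))))"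
        using si by (simp only: set_integrable_def)
    qed (use il in \<open>auto simp: indicator_def\<close>)
    also have "\<dots> = L1norm G"
      unfolding L1norm_def using lborel_integral_real_affine[of 1 "\<lambda>t. norm (G (of_real t))" x] by simp
    finally show ?thesis using N by simp
  qed
  \<comment> \<open>The exponential compensates the growth of \<open>\<Gamma>\<close> in the upper
    half-plane. The resulting bound still depends on the length of the segment, but the half-plane
    principle discards it.\<close>
  define P where "P z = \<Gamma> z * exp (\<i> * of_real \<sigma> * z) / of_real N" for z
  have nP: "norm (P z) = norm (\<Gamma> z) * exp (- (\<sigma> * Im z)) / N" for z
    using N by (simp add: P_def norm_mult norm_divide)
  have holP: "P holomorphic_on UNIV" unfolding P_def using N by (intro holomorphic_intros hol\<Gamma>) auto
  have "norm (P (\<i> * of_real b)) \<le> 1"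
  proof (rule half_plane_maximum_modulus[where f = P and M = "C * (x1 - x0) / N"])
    show "P holomorphic_on {z. Im z > 0}" using holP by (rule holomorphic_on_subset) simp
    show "continuous_on {z. Im z \<ge> 0} P"
      using holomorphic_on_imp_continuous_on[OF holP] by (rule continuous_on_subset) simp
    show "norm (P z) \<le> 1" if "Im z = 0" for z
    proof -
      have "z = of_real (Re z)" using that by (simp add: complex_eq_iff)
      hence "norm (\<Gamma> z) \<le> N" using real[of "Re z"] by simp
      thus ?thesis using that N by (simp add: nP)
    qed
    show "norm (P z) \<le> C * (x1 - x0) / N" if "Im z \<ge> 0" for z
    proof -
      have "norm (\<Gamma> z) \<le> (C * exp (\<sigma> * Im z)) * (x1 - x0)"
        unfolding \<Gamma>_def cbox_interval
      proof (rule integral_bound[OF ab contI])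
        fix t
        have "norm (G (of_real t + z)) \<le> C * exp (\<sigma> * Im z)" using growth[of "of_real t + z"] that by simp
        thus "norm (G (of_real t + z) * s t) \<le> C * exp (\<sigma> * Im z)"
          using s1[of t] C mult_mono[of "norm (G (of_real t + z))" _ "norm (s t)" 1] by (simp add: norm_mult)
      qed
      hence "norm (\<Gamma> z) * exp (- (\<sigma> * Im z)) \<le> C * exp (\<sigma> * Im z) * (x1 - x0) * exp (- (\<sigma> * Im z))"
        by (rule mult_right_mono) simp
      also have "\<dots> = C * (x1 - x0)" by (simp add: exp_minus field_simps)
      finally show ?thesis using N by (simp add: nP divide_right_mono)
    qed
  qed (use b in auto)
  moreover have "\<Gamma> (\<i> * of_real b) = of_real (integral {x0..x1} (\<lambda>t. norm (G (Complex t b))))"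
  proof -
    have "\<Gamma> (\<i> * of_real b) = integral {x0..x1} (\<lambda>t. of_real (norm (G (Complex t b))))"
      unfolding \<Gamma>_def cbox_interval
    proof (rule Henstock_Kurzweil_Integration.integral_cong)
      fix t assume "t \<in> {x0..x1}"
      define w where "w = G (of_real t + \<i> * of_real b)"
      have "w * (cnj w / of_real (norm w)) = of_real (norm w)"
        using complex_norm_square[of w] by (cases "w = 0") (simp_all add: power2_eq_square divide_eq_eq)
      thus "G (of_real t + \<i> * of_real b) * s t = of_real (norm (G (Complex t b)))"
        by (simp add: s_def w_def Cx)
    qed
    also have "\<dots> = of_real (integral {x0..x1} (\<lambda>t. norm (G (Complex t b))))"
      using integral_linear[OF _ bounded_linear_of_real, of "\<lambda>t. norm (G (Complex t b))" "{x0..x1}"]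
      by (simp add: o_def integrable_continuous_interval continuous_intros contG Cx)
    finally show ?thesis .
  qed
  moreover have "integral {x0..x1} (\<lambda>t. norm (G (Complex t b))) \<ge> 0"
    by (rule Henstock_Kurzweil_Integration.integral_nonneg)
       (auto intro!: integrable_continuous_interval continuous_intros contG simp: Cx)
  ultimately have "integral {x0..x1} (\<lambda>t. norm (G (Complex t b))) * exp (- (\<sigma> * b)) / N \<le> 1"
    unfolding nP by simp
  hence "integral {x0..x1} (\<lambda>t. norm (G (Complex t b))) \<le> exp (\<sigma> * b) * N"
    using N by (simp add: exp_minus field_simps)
  thus ?thesis by (simp only: N_def)
qed

lemma L1norm_reflect:
  shows "L1norm (\<lambda>z. cnj (G (cnj z))) = L1norm G"
  by (simp add: L1norm_def)

lemma line_integral_bound: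
  assumes hol: "G holomorphic_on UNIV" and int: "integrable lborel (\<lambda>t::real. G (of_real t))"
    and growth: "\<And>z. norm (G z) \<le> C * exp (\<sigma> * \<bar>Im z\<bar>)"
    and ab: "x0 \<le> x1"
    and nz: "\<And>t. x0 \<le> t \<Longrightarrow> t \<le> x1 \<Longrightarrow> G (Complex t b) \<noteq> 0"
  shows "integral {x0..x1} (\<lambda>t. norm (G (Complex t b))) \<le> exp (\<sigma> * \<bar>b\<bar>) * (L1norm G + 1)"
proof (cases "b \<ge> 0")
  case True
  thus ?thesis using upper_line_integral_bound[OF hol int growth True ab nz] by simp
next
  case False
  have cC: "cnj (Complex t (- b)) = Complex t b" for t by (simp add: complex_eq_iff)
  have "integral {x0..x1} (\<lambda>t. norm (cnj (G (cnj (Complex t (- b)))))) \<le>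
      exp (\<sigma> * (- b)) * (L1norm (\<lambda>z. cnj (G (cnj z))) + 1)"
  proof (rule upper_line_integral_bound[OF holomorphic_reflect[OF hol] _ _ _ ab])
    show "integrable lborel (\<lambda>t::real. cnj (G (cnj (of_real t))))" using int by simp
    show "norm (cnj (G (cnj z))) \<le> C * exp (\<sigma> * \<bar>Im z\<bar>)" for z using growth[of "cnj z"] by simp
  qed (use nz False in \<open>auto simp: cC\<close>)
  thus ?thesis using False by (simp add: cC L1norm_reflect)
qed

section \<open>Growth of the quotient and the type of the denominator\<close>

text \<open>Translation by \<i> b moves the line Im z = -b to the real axis. \<open>F\<close> is the
  translated \<open>f\<close> with its exponential growth removed, and \<open>k\<close> is the
  translated \<open>h\<close> divided by a power whose only zero, -\<i> b, lies below the half-plane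
  and which has on the real axis the same modulus as the power in the boundary bound.\<close>

lemma entire_quotient_growth:
  assumes f: "f holomorphic_on UNIV" and h: "h holomorphic_on UNIV"
    and b: "b > 0" and C: "C > 0" and \<sigma>: "\<sigma> > 0"
    and fC: "\<And>z. norm (f z) \<le> C * exp (\<sigma> * \<bar>Im z\<bar>)"
    and hf: "\<And>z. norm (h z * f z) \<le> C' * exp (\<sigma> * \<bar>Im z\<bar>)"
    and K: "K > 0" "\<And>z. Im z = - b \<Longrightarrow> norm (h z) \<le> K * norm z ^ n"
    and type: "\<And>\<epsilon>. \<epsilon> > 0 \<Longrightarrow>
       \<exists>z. Im z > 0 \<and> norm (f (z - \<i> * of_real b)) \<ge> C * exp (\<sigma> * b) * exp ((\<sigma> - \<epsilon>) * Im z)"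
  obtains K' where "\<And>z. Im z \<ge> - b \<Longrightarrow> norm (h z) \<le> K' * norm (z + 2 * \<i> * of_real b) ^ n"
proof -
  have "0 \<le> C' * exp (\<sigma> * \<bar>Im 0\<bar>)" by (rule order_trans[OF norm_ge_zero hf])
  hence C': "C' \<ge> 0" by simp
  \<comment> \<open>The exponential factor pays for the translation, since |Im z - b| \<le> Im z +
    b. In \<open>K'\<close>, the summand \<open>K\<close> serves the boundary bound on
    \<open>k\<close> and the other one the bound on \<open>k * F\<close>, where |z + \<i> b| \<ge>
    b.\<close>
  define D where "D = C * exp (\<sigma> * b)"
  define K' where "K' = K + C' / (C * b ^ n)"
  have D: "D > 0" using C by (simp add: D_def)
  have K': "K' \<ge> K" "K' > 0" "C' \<le> C * (K' * b ^ n)"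
  proof -
    have "C' / (C * b ^ n) \<ge> 0" using C C' b by simp
    thus "K' \<ge> K" "K' > 0" using K(1) by (auto simp: K'_def)
    have "C * (K' * b ^ n) = C * K * b ^ n + C'" using C b by (simp add: K'_def field_simps)
    thus "C' \<le> C * (K' * b ^ n)" using C K(1) b by simp
  qed
  define F where "F z = f (z - \<i> * of_real b) * exp (\<i> * of_real \<sigma> * z) / of_real D" for z
  define k where "k z = h (z - \<i> * of_real b) / (of_real K' * (z + \<i> * of_real b) ^ n)" for z
  have comp: "(\<lambda>z. u (z - \<i> * of_real b)) holomorphic_on A" if "u holomorphic_on UNIV" for u A
    using holomorphic_on_compose_gen[OF _ that, of "\<lambda>z. z - \<i> * of_real b" A]
    by (simp add: o_def holomorphic_intros)
  have nF: "norm (F z) = norm (f (z - \<i> * of_real b)) * exp (- (\<sigma> * Im z)) / D" for z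
    using D by (simp add: F_def norm_mult norm_divide)
  have nz: "z + \<i> * of_real b \<noteq> 0" if "Im z \<ge> 0" for z using that b by (auto simp: complex_eq_iff)
  have nb: "b \<le> norm (z + \<i> * of_real b)" if "Im z \<ge> 0" for z
    using abs_Im_le_cmod[of "z + \<i> * of_real b"] that b by simp
  have expo: "exp (\<sigma> * \<bar>Im z - b\<bar>) * exp (- (\<sigma> * Im z)) \<le> exp (\<sigma> * b)" if "Im z \<ge> 0" for z
  proof -
    have "\<sigma> * \<bar>Im z - b\<bar> \<le> \<sigma> * (Im z + b)" using that b \<sigma> by (intro mult_left_mono) auto
    thus ?thesis by (simp add: exp_add[symmetric] algebra_simps)
  qed
  have k1: "norm (k z) \<le> 1" if "Im z \<ge> 0" for z
  proof (rule half_plane_quotient_bound[where F = F and k = k])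
    show "F holomorphic_on UNIV" unfolding F_def using D by (intro holomorphic_intros comp f) auto
    show "k holomorphic_on {z. Im z > 0}" unfolding k_def
      using K' nz by (intro holomorphic_intros comp h) auto
    have "(\<lambda>z. h (z - \<i> * of_real b)) holomorphic_on {z. Im z \<ge> 0}" by (rule comp[OF h])
    thus "continuous_on {z. Im z \<ge> 0} k" unfolding k_def
      using K' nz by (intro continuous_intros holomorphic_on_imp_continuous_on) auto
  next
    fix w assume w: "Im w \<ge> 0"
    have e: "c * exp (\<sigma> * \<bar>Im w - b\<bar>) * exp (- (\<sigma> * Im w)) \<le> c * exp (\<sigma> * b)" if "c \<ge> 0" for c
      using mult_left_mono[OF expo[OF w] that] by (simp add: mult.assoc)
    have "norm (f (w - \<i> * of_real b)) * exp (- (\<sigma> * Im w)) \<le> C * exp (\<sigma> * \<bar>Im w - b\<bar>) * exp (- (\<sigma> * Im w))"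
      using fC[of "w - \<i> * of_real b"] by (intro mult_right_mono) auto
    also have "\<dots> \<le> D" unfolding D_def using e C by simp
    finally show "norm (F w) \<le> 1" using D by (simp add: nF)
    define r where "r = norm (w + \<i> * of_real b) ^ n"
    have r: "r \<ge> b ^ n" unfolding r_def using nb[OF w] b by (intro power_mono) auto
    have rpos: "r > 0" using r b by (meson less_le_trans zero_less_power)
    have "norm (h (w - \<i> * of_real b) * f (w - \<i> * of_real b)) * exp (- (\<sigma> * Im w))
        \<le> C' * exp (\<sigma> * \<bar>Im w - b\<bar>) * exp (- (\<sigma> * Im w))"
      using hf[of "w - \<i> * of_real b"] by (intro mult_right_mono) auto
    also have "\<dots> \<le> C' * exp (\<sigma> * b)" using e C' by simp
    also have "\<dots> \<le> C * (K' * b ^ n) * exp (\<sigma> * b)" using K' by (intro mult_right_mono) auto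
    also have "\<dots> \<le> C * (K' * r) * exp (\<sigma> * b)" using K' r C by (intro mult_right_mono mult_left_mono) auto
    also have "\<dots> = D * (K' * r)" by (simp add: D_def)
    finally have "norm (h (w - \<i> * of_real b)) * norm (f (w - \<i> * of_real b)) * exp (- (\<sigma> * Im w)) / (D * (K' * r)) \<le> 1"
      using D K' rpos by (simp add: norm_mult)
    moreover have "norm (k w * F w) = norm (h (w - \<i> * of_real b)) * norm (f (w - \<i> * of_real b)) * exp (- (\<sigma> * Im w)) / (D * (K' * r))"
      using K' by (simp add: norm_mult nF k_def norm_divide norm_power r_def)
    ultimately show "norm (k w * F w) \<le> 1" by simp
  next
    fix w assume w: "Im w = 0"
    have "norm (w - \<i> * of_real b) = norm (w + \<i> * of_real b)" using w by (simp add: cmod_def)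
    hence "norm (h (w - \<i> * of_real b)) \<le> K * norm (w + \<i> * of_real b) ^ n"
      using K(2)[of "w - \<i> * of_real b"] w by simp
    also have "\<dots> \<le> K' * norm (w + \<i> * of_real b) ^ n" using K' by (intro mult_right_mono) auto
    finally show "norm (k w) \<le> 1"
      using K' nz[of w] w by (simp add: k_def norm_mult norm_divide norm_power divide_le_eq)
  next
    fix \<epsilon> :: real assume "\<epsilon> > 0"
    then obtain z where z: "Im z > 0" "norm (f (z - \<i> * of_real b)) \<ge> D * exp ((\<sigma> - \<epsilon>) * Im z)"
      using type unfolding D_def by blast
    have "D * exp (- \<epsilon> * Im z) = D * exp ((\<sigma> - \<epsilon>) * Im z) * exp (- (\<sigma> * Im z))"
      by (simp add: mult.assoc exp_add[symmetric] algebra_simps)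
    also have "\<dots> \<le> norm (f (z - \<i> * of_real b)) * exp (- (\<sigma> * Im z))"
      using z(2) by (intro mult_right_mono) auto
    finally have "exp (- \<epsilon> * Im z) \<le> norm (F z)" using D by (simp add: nF field_simps)
    thus "\<exists>z1. Im z1 > 0 \<and> norm (F z1) \<ge> exp (- \<epsilon> * Im z1)" using z(1) by blast
  qed (use that in simp)
  show ?thesis
  proof (rule that)
    fix z assume z: "Im z \<ge> - b"
    have "norm (k (z + \<i> * of_real b)) \<le> 1" using z by (intro k1) simp
    moreover have "z + \<i> * of_real b + \<i> * of_real b = z + 2 * \<i> * of_real b" by (simp add: algebra_simps)
    moreover have "z + 2 * \<i> * of_real b \<noteq> 0" using z b by (auto simp: complex_eq_iff)
    ultimately show "norm (h z) \<le> K' * norm (z + 2 * \<i> * of_real b) ^ n"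
      using K' by (simp add: k_def norm_mult norm_divide norm_power divide_le_eq)
  qed
qed

text \<open>Failure in both half-planes would bound \<open>f\<close> by a multiple of exp ((\<sigma>
  - \<epsilon>) |Im w|) in the whole plane, hence give a smaller type. Neither the constant
  \<open>D\<close> nor the translation by \<open>b\<close> affects the type.\<close>

lemma exp_type_attained_in_half_plane:
  assumes type: "exp_type f = \<sigma>" and \<sigma>: "\<sigma> > 0" and D: "D > 0" and b: "b > 0"
  shows "(\<forall>\<epsilon>>0. \<exists>z. Im z > 0 \<and> norm (f (z - \<i> * of_real b)) \<ge> D * exp ((\<sigma> - \<epsilon>) * Im z)) \<or>
    (\<forall>\<epsilon>>0. \<exists>z. Im z > 0 \<and> norm (cnj (f (cnj (z - \<i> * of_real b)))) \<ge> D * exp ((\<sigma> - \<epsilon>) * Im z))"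
proof (rule ccontr)
  assume "\<not> ?thesis"
  then obtain \<epsilon>1 \<epsilon>2 where e: "\<epsilon>1 > 0" "\<epsilon>2 > 0"
    and lo: "\<And>z::complex. Im z > 0 \<Longrightarrow> norm (f (z - \<i> * of_real b)) < D * exp ((\<sigma> - \<epsilon>1) * Im z)"
    and hi: "\<And>z::complex. Im z > 0 \<Longrightarrow> norm (f (cnj (z - \<i> * of_real b))) < D * exp ((\<sigma> - \<epsilon>2) * Im z)"
    by (auto simp: not_le)
  \<comment> \<open>The minimum with \<open>\<sigma>\<close> keeps
    \<open>\<sigma> - \<epsilon>\<close> nonnegative, as the set in \<open>exp_type\<close>
    demands.\<close>
  define \<epsilon> where "\<epsilon> = min \<sigma> (min \<epsilon>1 \<epsilon>2)"
  have \<epsilon>: "\<epsilon> > 0" "\<epsilon> \<le> \<sigma>" "\<epsilon> \<le> \<epsilon>1" "\<epsilon> \<le> \<epsilon>2" using e \<sigma> by (auto simp: \<epsilon>_def)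
  have bound: "norm (f w) \<le> D * exp ((\<sigma> - \<epsilon>) * b) * exp ((\<sigma> - \<epsilon>) * norm w)" for w
  proof -
    have *: "norm (f w) \<le> D * exp ((\<sigma> - \<epsilon>) * b) * exp ((\<sigma> - \<epsilon>) * norm w)"
      if "norm (f w) < D * exp ((\<sigma> - \<delta>) * (\<bar>Im w\<bar> + b))" "\<epsilon> \<le> \<delta>" for \<delta>
    proof -
      have "(\<sigma> - \<delta>) * (\<bar>Im w\<bar> + b) \<le> (\<sigma> - \<epsilon>) * (\<bar>Im w\<bar> + b)"
        using that(2) b by (intro mult_right_mono) auto
      also have "\<dots> \<le> (\<sigma> - \<epsilon>) * (norm w + b)"
        using \<epsilon>(2) abs_Im_le_cmod[of w] by (intro mult_left_mono) auto
      finally have "D * exp ((\<sigma> - \<delta>) * (\<bar>Im w\<bar> + b)) \<le> D * exp ((\<sigma> - \<epsilon>) * (norm w + b))"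
        using D by simp
      thus ?thesis using that(1) by (simp add: distrib_left exp_add mult_ac)
    qed
    show ?thesis
    proof (cases "Im w \<ge> 0")
      case True
      thus ?thesis using lo[of "w + \<i> * of_real b"] b \<epsilon>(3) by (intro *[of \<epsilon>1]) auto
    next
      case False
      thus ?thesis using hi[of "cnj w + \<i> * of_real b"] b \<epsilon>(4) by (intro *[of \<epsilon>2]) auto
    qed
  qed
  have "exp_type f \<le> \<sigma> - \<epsilon>"
    unfolding exp_type_def
  proof (rule cInf_lower)
    show "\<sigma> - \<epsilon> \<in> {a. a \<ge> 0 \<and> (\<forall>\<epsilon>>0. \<exists>M. \<forall>z. norm (f z) \<le> M * exp ((a + \<epsilon>) * norm z))}"
    proof (intro CollectI conjI allI impI)
      show "\<sigma> - \<epsilon> \<ge> 0" using \<epsilon>(2) by simp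
      fix \<delta> :: real assume \<delta>: "\<delta> > 0"
      show "\<exists>M. \<forall>z. norm (f z) \<le> M * exp ((\<sigma> - \<epsilon> + \<delta>) * norm z)"
      proof (intro exI allI)
        fix z :: complex
        have "D * exp ((\<sigma> - \<epsilon>) * b) * exp ((\<sigma> - \<epsilon>) * norm z) \<le> D * exp ((\<sigma> - \<epsilon>) * b) * exp ((\<sigma> - \<epsilon> + \<delta>) * norm z)"
          using D \<delta> by (simp add: mult_right_mono)
        thus "norm (f z) \<le> D * exp ((\<sigma> - \<epsilon>) * b) * exp ((\<sigma> - \<epsilon> + \<delta>) * norm z)"
          using bound[of z] by linarith
      qed
    qed
    show "bdd_below {a. a \<ge> 0 \<and> (\<forall>\<epsilon>>0. \<exists>M. \<forall>z. norm (f z) \<le> M * exp ((a + \<epsilon>) * norm z))}"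
      by (rule bdd_belowI[of _ 0]) simp
  qed
  thus False using type \<epsilon>(1) by simp
qed

section \<open>The functional given by the sign of \<open>f\<close>\<close>

lemma Bernstein1_integrable_sgn:
  assumes "g \<in> Bernstein1 \<sigma>" "f \<in> Bernstein1 \<sigma>"
  shows "integrable lborel (\<lambda>x::real. g (of_real x) * cnj (sgn (f (of_real x))))"
proof (rule Bochner_Integration.integrable_bound)
  show "integrable lborel (\<lambda>x::real. g (of_real x))" using assms by (simp add: Bernstein1_def)
  have [measurable]: "(\<lambda>x::real. g (of_real x)) \<in> borel_measurable borel"
    "(\<lambda>x::real. f (of_real x)) \<in> borel_measurable borel"
    using assms by (auto simp: Bernstein1_def dest!: borel_measurable_integrable)
  have [measurable]: "cnj \<in> borel_measurable borel"
    by (intro borel_measurable_continuous_onI continuous_intros)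
  show "(\<lambda>x::real. g (of_real x) * cnj (sgn (f (of_real x)))) \<in> borel_measurable lborel"
    unfolding sgn_div_norm by measurable
qed (auto simp: norm_mult norm_sgn)

lemma sgn_duality_bound:
  assumes "g \<in> Bernstein1 \<sigma>" "f \<in> Bernstein1 \<sigma>"
  shows "norm (LINT x|lborel. g (of_real x) * cnj (sgn (f (of_real x)))) \<le> L1norm g"
proof -
  have "norm (LINT x|lborel. g (of_real x) * cnj (sgn (f (of_real x)))) \<le>
      (LINT x|lborel. norm (g (of_real x) * cnj (sgn (f (of_real x)))))"
    by (rule integral_norm_bound)
  also have "\<dots> \<le> L1norm g"
    unfolding L1norm_def using Bernstein1_integrable_sgn[OF assms] assms
    by (intro integral_mono integrable_norm) (auto simp: Bernstein1_def norm_mult norm_sgn)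
  finally show ?thesis .
qed

lemma Bernstein1_lincomb:
  assumes g: "g \<in> Bernstein1 \<sigma>" and h: "h \<in> Bernstein1 \<sigma>"
  shows "(\<lambda>z. a * g z + b * h z) \<in> Bernstein1 \<sigma>"
proof -
  have [measurable]: "(\<lambda>t::real. cis (- (\<xi> * t))) \<in> borel_measurable borel" for \<xi>
    by (intro borel_measurable_continuous_onI continuous_intros)
  have int: "integrable lborel (\<lambda>x::real. u (of_real x) * cis (- (\<xi> * x)))" if "u \<in> Bernstein1 \<sigma>" for u \<xi>
  proof (rule Bochner_Integration.integrable_bound)
    show "integrable lborel (\<lambda>x::real. u (of_real x))" using that by (simp add: Bernstein1_def)
    hence [measurable]: "(\<lambda>x::real. u (of_real x)) \<in> borel_measurable borel"
      by (auto dest!: borel_measurable_integrable)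
    show "(\<lambda>x::real. u (of_real x) * cis (- (\<xi> * x))) \<in> borel_measurable lborel" by measurable
  qed (auto simp: norm_mult)
  have "fourier_real (\<lambda>z. a * g z + b * h z) \<xi> = a * fourier_real g \<xi> + b * fourier_real h \<xi>" for \<xi>
    unfolding fourier_real_def using int[OF g, of \<xi>] int[OF h, of \<xi>]
    by (simp add: distrib_right mult.assoc)
  thus ?thesis using g h by (auto simp: Bernstein1_def intro!: holomorphic_intros)
qed

text \<open>This is the equality case of the integral inequality behind
  \<open>sgn_duality_bound\<close>: the nonnegative defect \<open>d\<close> has integral 0, so it
  vanishes almost everywhere.\<close>

lemma sgn_duality_equality:
  assumes g: "g \<in> Bernstein1 \<sigma>" and f: "f \<in> Bernstein1 \<sigma>"
    and le: "L1norm g \<le> Re (LINT x|lborel. g (of_real x) * cnj (sgn (f (of_real x))))"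
    and nz: "f (of_real x) \<noteq> 0"
  shows "g (of_real x) / f (of_real x) \<in> \<real>\<^sub>\<ge>\<^sub>0"
proof -
  define d where "d x = norm (g (of_real x)) - Re (g (of_real x) * cnj (sgn (f (of_real x))))" for x :: real
  have le1: "Re (g (of_real x) * cnj (sgn (f (of_real x)))) \<le> norm (g (of_real x))" for x :: real
  proof -
    have "Re (g (of_real x) * cnj (sgn (f (of_real x)))) \<le> norm (g (of_real x) * cnj (sgn (f (of_real x))))"
      by (rule complex_Re_le_cmod)
    also have "\<dots> \<le> norm (g (of_real x))" by (simp add: norm_mult norm_sgn)
    finally show ?thesis .
  qed
  hence d0: "d x \<ge> 0" for x by (simp add: d_def)
  define p where "p x = g (of_real x) * cnj (sgn (f (of_real x)))" for x :: real
  have int: "integrable lborel p" unfolding p_def by (rule Bernstein1_integrable_sgn[OF g f])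
  have gi: "integrable lborel (\<lambda>x::real. norm (g (of_real x)))"
    using g by (simp add: Bernstein1_def)
  have intd: "integrable lborel d"
    unfolding d_def p_def[symmetric] using int gi by (intro Bochner_Integration.integrable_diff integrable_Re)
  have "integral\<^sup>L lborel d = L1norm g - Re (LINT x|lborel. g (of_real x) * cnj (sgn (f (of_real x))))"
    unfolding d_def L1norm_def p_def[symmetric] using int gi
    by (subst Bochner_Integration.integral_diff) (auto intro: integrable_Re simp: Bochner_Integration.integral_Re)
  hence "integral\<^sup>L lborel d = 0"
    using le Bochner_Integration.integral_nonneg[of lborel d, OF d0] by simp
  hence AE: "AE x in lborel. d x = 0"
    using integral_nonneg_eq_0_iff_AE[OF intd] d0 by simp
  \<comment> \<open>\<open>sgn\<close> is discontinuous at 0, so \<open>d\<close> need not be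
    continuous. Multiplication by |f| repairs this, and a continuous function that vanishes almost
    everywhere vanishes everywhere.\<close>
  define D where "D x = norm (g (of_real x)) * norm (f (of_real x)) - Re (g (of_real x) * cnj (f (of_real x)))" for x :: real
  have Dd: "D x = norm (f (of_real x)) * d x" for x
  proof -
    have "f (of_real x) = of_real (norm (f (of_real x))) * sgn (f (of_real x))"
      using scaleR_conv_of_real[of "norm (f (of_real x))" "sgn (f (of_real x))"]
      by (cases "f (of_real x) = 0") (simp_all add: sgn_div_norm)
    hence "cnj (f (of_real x)) = of_real (norm (f (of_real x))) * cnj (sgn (f (of_real x)))"
      by (metis complex_cnj_complex_of_real complex_cnj_mult)
    hence "g (of_real x) * cnj (f (of_real x)) = of_real (norm (f (of_real x))) * (g (of_real x) * cnj (sgn (f (of_real x))))"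
      by simp
    moreover have "Re (of_real r * w) = r * Re w" for r w by simp
    ultimately have "Re (g (of_real x) * cnj (f (of_real x))) = norm (f (of_real x)) * Re (g (of_real x) * cnj (sgn (f (of_real x))))"
      by presburger
    thus ?thesis by (simp add: D_def d_def algebra_simps)
  qed
  have cont: "continuous_on UNIV (\<lambda>x::real. u (of_real x))" if "u \<in> Bernstein1 \<sigma>" for u
  proof (rule continuous_on_compose2[of UNIV u])
    show "continuous_on UNIV u" using that by (simp add: Bernstein1_def holomorphic_on_imp_continuous_on)
  qed (auto intro!: continuous_intros)
  have "D x = 0"
  proof (rule continuous_AE_zero[of D])
    show "continuous_on UNIV D" unfolding D_def by (intro continuous_intros cont f g)
    show "AE x in lborel. D x = 0" using AE by eventually_elim (simp add: Dd)
  qed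
  hence eq: "Re (g (of_real x) * cnj (f (of_real x))) = norm (g (of_real x) * cnj (f (of_real x)))"
    by (simp add: D_def norm_mult)
  hence "g (of_real x) * cnj (f (of_real x)) \<in> \<real>\<^sub>\<ge>\<^sub>0"
  proof -
    define w where "w = g (of_real x) * cnj (f (of_real x))"
    have "Re w = norm w" using eq by (simp add: w_def)
    hence "(Re w)\<^sup>2 = (Re w)\<^sup>2 + (Im w)\<^sup>2" by (metis cmod_power2)
    hence "Im w = 0" by simp
    moreover have "Re w \<ge> 0" using \<open>Re w = norm w\<close> by simp
    ultimately show ?thesis by (simp add: complex_nonneg_Reals_iff w_def)
  qed
  moreover have "of_real (norm (f (of_real x)) ^ 2) \<in> (\<real>\<^sub>\<ge>\<^sub>0 :: complex set)"
    unfolding nonneg_Reals_of_real_iff by simp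
  ultimately have "g (of_real x) * cnj (f (of_real x)) / of_real (norm (f (of_real x)) ^ 2) \<in> \<real>\<^sub>\<ge>\<^sub>0"
    by (rule nonneg_Reals_divide_I)
  thus ?thesis by (subst complex_div_cnj) simp
qed

section \<open>Constancy of the quotient\<close>

lemma inverse_growth_not_integrable:
  fixes u :: "real \<Rightarrow> real"
  assumes c: "c > 0" and X: "X \<ge> 1" and cont: "continuous_on UNIV u"
    and lower: "\<And>t. t \<ge> X \<Longrightarrow> u t \<ge> c / t"
  shows "\<exists>T\<ge>X. integral {X..T} u > B"
proof -
  \<comment> \<open>Chosen so that c ln (T / X) = |B| + 1.\<close>
  define T where "T = X * exp ((\<bar>B\<bar> + 1) / c)"
  have T: "T \<ge> X" unfolding T_def using X c by (simp add: mult_le_cancel_left1)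
  have "((\<lambda>t. c / t) has_integral c * ln T - c * ln X) {X..T}"
  proof (rule fundamental_theorem_of_calculus[OF T])
    fix t assume "t \<in> {X..T}"
    thus "((\<lambda>t. c * ln t) has_vector_derivative c / t) (at t within {X..T})"
      using X unfolding has_real_derivative_iff_has_vector_derivative[symmetric]
      by (auto intro!: derivative_eq_intros)
  qed
  moreover have "(u has_integral integral {X..T} u) {X..T}"
    by (intro integrable_integral integrable_continuous_interval continuous_on_subset[OF cont]) auto
  ultimately have "c * ln T - c * ln X \<le> integral {X..T} u"
    by (rule has_integral_le) (use lower in auto)
  moreover have "ln T = ln X + (\<bar>B\<bar> + 1) / c" unfolding T_def using X by (subst ln_mult) auto
  hence "c * ln T - c * ln X = \<bar>B\<bar> + 1" using c by (simp add: distrib_left del: times_divide_eq_right) simp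
  ultimately have "integral {X..T} u > B" by linarith
  thus ?thesis using T by blast
qed

lemma polynomial_lower_growth:
  fixes a :: "nat \<Rightarrow> complex"
  assumes "a m \<noteq> 0" and top: "\<And>j. j > m \<Longrightarrow> j \<le> n \<Longrightarrow> a j = 0" and "m \<le> n"
  shows "\<exists>c>0. eventually (\<lambda>w. norm (\<Sum>j\<le>n. a j * w ^ j) \<ge> c * norm w ^ m) at_infinity"
proof -
  have sum: "(\<Sum>j\<le>n. a j * w ^ j) = (\<Sum>j\<le>m. a j * w ^ j)" for w
    by (rule sum.mono_neutral_right) (use assms in \<open>auto simp: not_le\<close>)
  have "((\<lambda>w. \<Sum>j\<le>m. a j * (w ^ j / w ^ m)) \<longlongrightarrow> (\<Sum>j\<le>m. a j * (if j = m then 1 else 0))) at_infinity"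
  proof (intro tendsto_sum tendsto_mult tendsto_const)
    fix j assume j: "j \<in> {..m}"
    show "((\<lambda>w::complex. w ^ j / w ^ m) \<longlongrightarrow> (if j = m then 1 else 0)) at_infinity"
    proof (cases "j = m")
      case True
      have "eventually (\<lambda>w::complex. 1 = w ^ j / w ^ m) at_infinity"
        using eventually_not_equal_at_infinity[of 0] by eventually_elim (simp add: True)
      thus ?thesis using True tendsto_eventually by (force elim: eventually_mono)
    next
      case False
      have "((\<lambda>w::complex. inverse w ^ (m - j)) \<longlongrightarrow> 0 ^ (m - j)) at_infinity"
        by (intro tendsto_power tendsto_inverse_0)
      hence "((\<lambda>w::complex. inverse (w ^ (m - j))) \<longlongrightarrow> 0) at_infinity"
        using False j by (simp add: power_inverse zero_power)
      moreover have "eventually (\<lambda>w::complex. inverse (w ^ (m - j)) = w ^ j / w ^ m) at_infinity"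
        using eventually_not_equal_at_infinity[of 0]
        by eventually_elim (use j in \<open>simp add: power_diff divide_simps\<close>)
      ultimately show ?thesis using False by (auto intro: Lim_transform_eventually)
    qed
  qed
  also have "(\<Sum>j\<le>m. a j * (if j = m then 1 else 0)) = a m" by (simp add: if_distrib cong: if_cong)
  finally have "eventually (\<lambda>w. norm (\<Sum>j\<le>m. a j * (w ^ j / w ^ m)) > norm (a m) / 2) at_infinity"
    using assms(1) by (intro order_tendstoD(1)[OF tendsto_norm]) auto
  hence "eventually (\<lambda>w. norm (\<Sum>j\<le>n. a j * w ^ j) \<ge> norm (a m) / 2 * norm w ^ m) at_infinity"
    using eventually_not_equal_at_infinity[of 0]
  proof eventually_elim
    case (elim w)
    have "(\<Sum>j\<le>m. a j * (w ^ j / w ^ m)) = (\<Sum>j\<le>n. a j * w ^ j) / w ^ m"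
      unfolding sum by (simp add: sum_divide_distrib)
    hence "norm (\<Sum>j\<le>m. a j * (w ^ j / w ^ m)) = norm (\<Sum>j\<le>n. a j * w ^ j) / norm w ^ m"
      by (simp only: norm_divide norm_power)
    hence "norm (a m) / 2 < norm (\<Sum>j\<le>n. a j * w ^ j) / norm w ^ m" using elim by simp
    thus ?case using elim by (simp add: pos_less_divide_eq)
  qed
  thus ?thesis using assms(1) by (intro exI[of _ "norm (a m) / 2"]) auto
qed

text \<open>Dividing the bound for \<open>h * f\<close> by the lower bound for \<open>f\<close>
  gives growth of order |z|^\<tau> on the line Im z = y0; symmetry of \<open>h\<close> carries it to
  Im z = -|y0| whatever the sign of \<open>y0\<close>.\<close>

lemma quotient_polynomial_on_lines:
  assumes hf: "\<And>z. norm (h z * f z) \<le> C * exp (\<sigma> * \<bar>Im z\<bar>)"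
    and sym: "\<And>z. h (cnj z) = cnj (h z)"
    and y0: "y0 \<noteq> 0" and \<tau>: "\<tau> > 0" "\<tau> \<le> 3" and \<delta>: "\<delta> > 0"
    and low: "\<And>x. \<delta> \<le> norm (Complex x y0) powr \<tau> * norm (f (Complex x y0))"
  obtains K where "K > 0" "\<And>z. Im z = - \<bar>y0\<bar> \<Longrightarrow> norm (h z) \<le> K * norm z ^ 3"
proof -
  define b where "b = \<bar>y0\<bar>"
  have b: "b > 0" using y0 by (simp add: b_def)
  have "0 \<le> C * exp (\<sigma> * \<bar>Im 0\<bar>)" by (rule order_trans[OF norm_ge_zero hf])
  hence C: "C \<ge> 0" by simp
  \<comment> \<open>The summand 1 / b^3 is for points with b \<le> r < 1, where r^3 is smaller than
    \<open>r powr \<tau>\<close> may be; there \<open>r powr \<tau>\<close> \<le> 1 \<le> r^3 /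
    b^3.\<close>
  define K where "K = C * exp (\<sigma> * b) / \<delta> * (1 + 1 / b ^ 3)"
  have line: "norm (h z) \<le> K * norm z ^ 3" if "Im z = y0" for z
  proof -
    define r where "r = norm z"
    have r: "r \<ge> b" using abs_Im_le_cmod[of z] that by (simp add: r_def b_def)
    have r0: "r > 0" using r b by linarith
    have z: "z = Complex (Re z) y0" using that by (simp add: complex_eq_iff)
    have "\<delta> \<le> r powr \<tau> * norm (f z)" using low[of "Re z"] by (simp add: z[symmetric] r_def)
    hence "norm (h z) * \<delta> \<le> norm (h z) * (r powr \<tau> * norm (f z))" by (rule mult_left_mono) simp
    also have "\<dots> = norm (h z * f z) * r powr \<tau>" by (simp add: norm_mult)
    also have "\<dots> \<le> C * exp (\<sigma> * b) * r powr \<tau>"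
      using hf[of z] that by (intro mult_right_mono) (auto simp: b_def)
    also have "\<dots> \<le> C * exp (\<sigma> * b) * ((1 + 1 / b ^ 3) * r ^ 3)"
    proof (intro mult_left_mono)
      show "r powr \<tau> \<le> (1 + 1 / b ^ 3) * r ^ 3"
      proof (cases "r \<ge> 1")
        case True
        have "r powr \<tau> \<le> r powr 3" using True \<tau> by (intro powr_mono) auto
        also have "\<dots> = r ^ 3" using r0 by simp
        also have "\<dots> \<le> (1 + 1 / b ^ 3) * r ^ 3" using r0 b by (simp add: distrib_right)
        finally show ?thesis .
      next
        case False
        have "r powr \<tau> \<le> 1" using False r0 \<tau> by (intro powr_le1) auto
        also have "1 \<le> r ^ 3 / b ^ 3" using r b power_mono[OF r, of 3] by simp
        also have "\<dots> \<le> (1 + 1 / b ^ 3) * r ^ 3" using r0 by (simp add: distrib_right)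
        finally show ?thesis .
      qed
    qed (use C in auto)
    finally show ?thesis using \<delta> by (simp add: K_def r_def field_simps)
  qed
  show ?thesis
  proof (rule that)
    have "K \<ge> 0" using C \<delta> b by (simp add: K_def)
    thus "K + 1 > 0" by simp
    fix z :: complex assume z: "Im z = - \<bar>y0\<bar>"
    have "norm (h z) \<le> K * norm z ^ 3"
    proof (cases "y0 < 0")
      case True thus ?thesis using line[of z] z by simp
    next
      case False thus ?thesis using line[of "cnj z"] z sym[of z] by simp
    qed
    also have "\<dots> \<le> (K + 1) * norm z ^ 3" by (intro mult_right_mono) auto
    finally show "norm (h z) \<le> (K + 1) * norm z ^ 3" .
  qed
qed

lemma nonneg_affine_constant:
  assumes "\<And>x::real. a + c * of_real x \<in> (\<real>\<^sub>\<ge>\<^sub>0 :: complex set)"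
  shows "c = 0" and "a \<in> \<real>\<^sub>\<ge>\<^sub>0"
proof -
  have n: "Re a + Re c * x \<ge> 0" "Im a + Im c * x = 0" for x :: real
    using assms[of x] by (auto simp: complex_nonneg_Reals_iff)
  show "a \<in> \<real>\<^sub>\<ge>\<^sub>0" using assms[of 0] by simp
  have "Im c = 0" using n(2)[of 0] n(2)[of 1] by simp
  moreover have "Re c = 0"
  proof (rule ccontr)
    assume "Re c \<noteq> 0"
    thus False using n(1)[of "- (Re a + 1) / Re c"] by simp
  qed
  ultimately show "c = 0" by (simp add: complex_eq_iff)
qed

lemma nonneg_quotient_constant:
  fixes \<sigma> \<tau> y0 \<delta> :: real and f g :: "complex \<Rightarrow> complex"
  assumes \<sigma>: "0 < \<sigma>" and f: "f \<in> Bernstein1 \<sigma>" and g: "g \<in> Bernstein1 \<sigma>"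
    and nz: "f z0 \<noteq> 0" and type: "exp_type f = \<sigma>"
    and conj: "no_conjugate_zeros f" and simple: "real_zeros_simple f"
    and \<tau>: "0 < \<tau>" "\<tau> \<le> 3" and y0: "y0 \<noteq> 0" and \<delta>: "\<delta> > 0"
    and low: "\<And>x. \<delta> \<le> norm (Complex x y0) powr \<tau> * norm (f (Complex x y0))"
    and quot: "\<And>x::real. f (of_real x) \<noteq> 0 \<Longrightarrow> g (of_real x) / f (of_real x) \<in> \<real>\<^sub>\<ge>\<^sub>0"
  obtains c where "c \<ge> 0" "\<And>z. g z = of_real c * f z"
proof -
  have fh: "f holomorphic_on UNIV" and gh: "g holomorphic_on UNIV"
    and gi: "integrable lborel (\<lambda>t::real. g (of_real t))"
    using f g by (auto simp: Bernstein1_def)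
  obtain h where h: "h holomorphic_on UNIV" "\<And>z. g z = h z * f z" "\<And>x::real. h (of_real x) \<in> \<real>\<^sub>\<ge>\<^sub>0"
    using entire_nonneg_quotient[OF fh gh nz conj simple quot] by blast
  have hreal: "cnj (h (of_real x)) = h (of_real x)" for x :: real
    using h(3)[of x] by (auto elim!: nonneg_Reals_cases)
  have sym': "cnj (h (cnj z)) = h z" for z
    by (rule entire_eq_if_eq_on_reals[where F = "\<lambda>z. cnj (h (cnj z))" and G = h])
       (simp_all add: hreal holomorphic_reflect h(1))
  have sym: "h (cnj z) = cnj (h z)" for z by (metis sym' complex_cnj_cnj)
  obtain C where C: "C > 0" "\<And>z. norm (f z) \<le> C * exp (\<sigma> * \<bar>Im z\<bar>)"
    using Bernstein1_growth[OF f \<sigma>] by blast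
  obtain C' where C': "C' > 0" "\<And>z. norm (g z) \<le> C' * exp (\<sigma> * \<bar>Im z\<bar>)"
    using Bernstein1_growth[OF g \<sigma>] by blast
  have hf: "norm (h z * f z) \<le> C' * exp (\<sigma> * \<bar>Im z\<bar>)" for z using C'(2)[of z] by (simp add: h(2))
  define b where "b = \<bar>y0\<bar>"
  have b: "b > 0" using y0 by (simp add: b_def)
  obtain K where K: "K > 0" "\<And>z. Im z = - b \<Longrightarrow> norm (h z) \<le> K * norm z ^ 3"
    using quotient_polynomial_on_lines[OF hf sym y0 \<tau> \<delta> low] unfolding b_def by blast
  \<comment> \<open>If the type of \<open>f\<close> is attained only in the lower half-plane, the
    reflection \<open>fs\<close> attains it in the upper one. Symmetry of \<open>h\<close> makes
    \<open>h * fs\<close> the reflection of \<open>g\<close>, so the same \<open>h\<close> can be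
    used.\<close>
  define fs where "fs z = cnj (f (cnj z))" for z
  have fsh: "fs holomorphic_on UNIV" unfolding fs_def[abs_def] by (rule holomorphic_reflect[OF fh])
  have fsC: "norm (fs z) \<le> C * exp (\<sigma> * \<bar>Im z\<bar>)" for z using C(2)[of "cnj z"] by (simp add: fs_def)
  have hfs: "norm (h z * fs z) \<le> C' * exp (\<sigma> * \<bar>Im z\<bar>)" for z
    using hf[of "cnj z"] by (simp add: fs_def sym norm_mult)
  have D: "C * exp (\<sigma> * b) > 0" using C by simp
  have "\<exists>K'. \<forall>z. Im z \<ge> - b \<longrightarrow> norm (h z) \<le> K' * norm (z + 2 * \<i> * of_real b) ^ 3"
    using exp_type_attained_in_half_plane[OF type \<sigma> D b]
  proof
    assume t: "\<forall>\<epsilon>>0. \<exists>z. Im z > 0 \<and> norm (f (z - \<i> * of_real b)) \<ge> C * exp (\<sigma> * b) * exp ((\<sigma> - \<epsilon>) * Im z)"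
    show ?thesis
      by (rule entire_quotient_growth[OF fh h(1) b C(1) \<sigma> C(2) hf K t[rule_format]]) auto
  next
    assume t: "\<forall>\<epsilon>>0. \<exists>z. Im z > 0 \<and> norm (cnj (f (cnj (z - \<i> * of_real b)))) \<ge> C * exp (\<sigma> * b) * exp ((\<sigma> - \<epsilon>) * Im z)"
    show ?thesis
      by (rule entire_quotient_growth[OF fsh h(1) b C(1) \<sigma> fsC hfs K t[folded fs_def, rule_format]]) auto
  qed
  then obtain K' where K': "\<And>z. Im z \<ge> - b \<Longrightarrow> norm (h z) \<le> K' * norm (z + 2 * \<i> * of_real b) ^ 3"
    by blast
  \<comment> \<open>Liouville's theorem wants a pure power of |z| outside a disc; for |z| \<ge> b
    the shifted norm is at most 3 |z|, and 27 = 3^3.\<close>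
  have half: "norm (h z) \<le> \<bar>K'\<bar> * 27 * norm z ^ 3" if "b \<le> norm z" "Im z \<ge> 0" for z
  proof -
    have "norm (z + 2 * \<i> * of_real b) \<le> norm z + 2 * b"
      using norm_triangle_ineq[of z "2 * \<i> * of_real b"] b by (simp add: norm_mult)
    hence "norm (z + 2 * \<i> * of_real b) ^ 3 \<le> (3 * norm z) ^ 3" using that(1) by (intro power_mono) auto
    hence "\<bar>K'\<bar> * norm (z + 2 * \<i> * of_real b) ^ 3 \<le> \<bar>K'\<bar> * (3 * norm z) ^ 3" by (rule mult_left_mono) simp
    moreover have "norm (h z) \<le> \<bar>K'\<bar> * norm (z + 2 * \<i> * of_real b) ^ 3"
      using K'[of z] that(2) b mult_right_mono[OF abs_ge_self[of K'], of "norm (z + 2 * \<i> * of_real b) ^ 3"]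
      by simp
    ultimately show ?thesis by (simp add: power_mult_distrib)
  qed
  have "norm (h z) \<le> \<bar>K'\<bar> * 27 * norm z ^ 3" if "b \<le> norm z" for z
    using half[of z] half[of "cnj z"] that sym[of z] by (cases "Im z \<ge> 0") auto
  define a where "a k = (deriv ^^ k) h 0 / fact k" for k
  have poly: "h z = (\<Sum>k\<le>3. a k * z ^ k)" for z
    unfolding a_def by (rule Liouville_polynomial[OF h(1), of b "\<bar>K'\<bar> * 27"]) fact
  have a23: "a 2 = 0 \<and> a 3 = 0"
  proof (rule ccontr)
    assume "\<not> (a 2 = 0 \<and> a 3 = 0)"
    hence "\<exists>m. (m = 2 \<or> m = 3) \<and> a m \<noteq> 0 \<and> (\<forall>j. j > m \<longrightarrow> j \<le> 3 \<longrightarrow> a j = 0)"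
    proof (cases "a 3 = 0")
      case True
      have "j > 2 \<longrightarrow> j \<le> 3 \<longrightarrow> a j = 0" for j
        using True by (cases "j = 3") auto
      thus ?thesis using True \<open>\<not> (a 2 = 0 \<and> a 3 = 0)\<close> by blast
    qed (auto intro!: exI[of _ 3])
    then obtain m where m: "m = 2 \<or> m = 3" "a m \<noteq> 0" "\<And>j. j > m \<Longrightarrow> j \<le> 3 \<Longrightarrow> a j = 0" by blast
    obtain c where c: "c > 0" "eventually (\<lambda>w. norm (h w) \<ge> c * norm w ^ m) at_infinity"
      using polynomial_lower_growth[of a m 3] m unfolding poly by auto
    then obtain R where R: "\<And>w. norm w \<ge> R \<Longrightarrow> norm (h w) \<ge> c * norm w ^ m"
      by (auto simp: eventually_at_infinity)
    define X where "X = max 1 (max R b)"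
    have X: "X \<ge> 1" "X \<ge> R" "X \<ge> b" by (auto simp: X_def)
    \<comment> \<open>The 2 comes from |w| \<le> t + |y0| \<le> 2 t, valid since \<open>X\<close> is
      at least |y0|.\<close>
    define c' where "c' = c * \<delta> / 2"
    have c': "c' > 0" using c \<delta> by (simp add: c'_def)
    have lower: "norm (g (Complex t y0)) \<ge> c' / t" if "t \<ge> X" for t
    proof -
      define w where "w = Complex t y0"
      define r where "r = norm w"
      have rt: "r \<ge> t" using abs_Re_le_cmod[of w] by (simp add: r_def w_def)
      have r2: "r \<le> 2 * t" using cmod_le[of w] that X by (simp add: r_def w_def b_def)
      have r1: "r \<ge> 1" "r \<ge> R" using rt that X by auto
      \<comment> \<open>Both possible degrees reduce to the exponent 2, and |h| |f| \<ge> c r^2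
        \<delta> / r^3 remains.\<close>
      have "r ^ 2 \<le> r ^ m" using m(1) r1 by (auto intro: power_increasing)
      hence "c * r ^ 2 \<le> c * r ^ m" using c by (intro mult_left_mono) auto
      also have "\<dots> \<le> norm (h w)" using R[of w] r1 by (simp add: r_def)
      finally have ch: "c * r ^ 2 \<le> norm (h w)" .
      have "\<delta> \<le> r powr \<tau> * norm (f w)" using low[of t] by (simp add: r_def w_def)
      also have "\<dots> \<le> r powr 3 * norm (f w)" using r1 \<tau> by (intro mult_right_mono powr_mono) auto
      also have "r powr 3 = r ^ 3" using r1 by simp
      finally have "\<delta> \<le> r ^ 3 * norm (f w)" .
      hence "c * r ^ 2 * \<delta> \<le> norm (h w) * (r ^ 3 * norm (f w))"
        using ch \<delta> by (intro mult_mono) auto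
      hence "r ^ 2 * (c * \<delta>) \<le> r ^ 2 * (r * norm (g w))"
        by (simp add: h(2) norm_mult power2_eq_square power3_eq_cube mult_ac)
      hence "c * \<delta> \<le> r * norm (g w)" using r1 by (subst (asm) mult_le_cancel_left_pos) auto
      also have "\<dots> \<le> 2 * t * norm (g w)" using r2 by (intro mult_right_mono) auto
      finally show ?thesis using that X by (simp add: c'_def w_def field_simps)
    qed
    have gc: "continuous_on UNIV (\<lambda>t. norm (g (Complex t y0)))"
    proof -
      have "Complex t y0 = of_real t + \<i> * of_real y0" for t by (simp add: complex_eq_iff)
      moreover have "continuous_on UNIV (\<lambda>t::real. norm (g (of_real t + \<i> * of_real y0)))"
        by (intro continuous_on_norm continuous_on_compose2[OF holomorphic_on_imp_continuous_on[OF gh]])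
           (auto intro!: continuous_intros)
      ultimately show ?thesis by simp
    qed
    obtain T where T: "T \<ge> X"
      "integral {X..T} (\<lambda>t. norm (g (Complex t y0))) > exp (\<sigma> * \<bar>y0\<bar>) * (L1norm g + 1)"
      using inverse_growth_not_integrable[OF c' X(1) gc lower] by blast
    \<comment> \<open>The lower bound does double duty: it also keeps \<open>g\<close> away from 0
      on the segment, as the line integral bound requires.\<close>
    have "integral {X..T} (\<lambda>t. norm (g (Complex t y0))) \<le> exp (\<sigma> * \<bar>y0\<bar>) * (L1norm g + 1)"
    proof (rule line_integral_bound[OF gh gi C'(2) T(1)])
      fix t assume "X \<le> t"
      hence "norm (g (Complex t y0)) \<ge> c' / t" "c' / t > 0" using lower X c' by auto
      thus "g (Complex t y0) \<noteq> 0" by auto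
    qed
    thus False using T(2) by simp
  qed
  have aff: "h z = a 0 + a 1 * z" for z
    unfolding poly using a23 by (simp add: eval_nat_numeral)
  have "a 1 = 0" "a 0 \<in> \<real>\<^sub>\<ge>\<^sub>0"
    using nonneg_affine_constant[of "a 0" "a 1"] h(3) by (auto simp: aff)
  then obtain c where "a 0 = of_real c" "c \<ge> 0" by (auto elim!: nonneg_Reals_cases)
  thus ?thesis using \<open>a 1 = 0\<close> by (intro that[of c]) (simp_all add: h(2) aff)
qed

section \<open>The exposing functional\<close>

theorem theorem3p1:
  fixes \<sigma> \<tau> y0 :: real and f :: "complex \<Rightarrow> complex"
  assumes "0 < \<sigma>"
    and "f \<in> Bernstein1 \<sigma>"
    and "L1norm f = 1"
    and "exp_type f = \<sigma>"
    and "no_conjugate_zeros f"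
    and "real_zeros_simple f"
    and "0 < \<tau>" and "\<tau> \<le> 3"
    and "(INF x::real. cmod (Complex x y0) powr \<tau> * cmod (f (Complex x y0))) > 0"
  shows "exposed_point \<sigma> f"
proof -
  define \<Phi> where "\<Phi> g = (LINT x|lborel. g (of_real x) * cnj (sgn (f (of_real x))))" for g :: "complex \<Rightarrow> complex"
  note f = assms(2)
  define \<delta> where "\<delta> = (INF x::real. cmod (Complex x y0) powr \<tau> * cmod (f (Complex x y0)))"
  have \<delta>: "\<delta> > 0" using assms(9) by (simp add: \<delta>_def)
  have low: "\<delta> \<le> cmod (Complex x y0) powr \<tau> * cmod (f (Complex x y0))" for x
    unfolding \<delta>_def by (rule cINF_lower) (auto intro: bdd_belowI[of _ 0])
  \<comment> \<open>For \<open>y0 = 0\<close> the infimum would vanish, because \<open>0 powr \<tau> = 0\<close>.\<close>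
  have y0: "y0 \<noteq> 0"
    using low[of 0] \<delta> by (auto simp: Complex_eq)
  obtain z0 where z0: "f z0 \<noteq> 0"
  proof (rule ccontr)
    assume "\<not> thesis"
    hence "f z = 0" for z using that by blast
    thus False using assms(3) by (simp add: L1norm_def)
  qed
  have lin: "\<Phi> (\<lambda>z. a * g z + b * h z) = a * \<Phi> g + b * \<Phi> h"
    if "g \<in> Bernstein1 \<sigma>" "h \<in> Bernstein1 \<sigma>" for g h and a b :: complex
    unfolding \<Phi>_def
    using Bernstein1_integrable_sgn[OF that(1) f] Bernstein1_integrable_sgn[OF that(2) f]
    by (simp add: distrib_right mult.assoc)
  have bd: "cmod (\<Phi> g) \<le> L1norm g" if "g \<in> Bernstein1 \<sigma>" for g
    unfolding \<Phi>_def by (rule sgn_duality_bound[OF that f])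
  have clf: "cont_linear_functional \<sigma> \<Phi>"
    unfolding cont_linear_functional_def
  proof (intro conjI ballI allI impI)
    fix g and \<epsilon> :: real assume g: "g \<in> Bernstein1 \<sigma>" and "\<epsilon> > 0"
    show "\<exists>\<delta>>0. \<forall>h\<in>Bernstein1 \<sigma>. L1norm (\<lambda>z. h z - g z) < \<delta> \<longrightarrow> cmod (\<Phi> h - \<Phi> g) < \<epsilon>"
    proof (intro exI[of _ \<epsilon>] conjI ballI impI)
      fix h assume h: "h \<in> Bernstein1 \<sigma>" and l: "L1norm (\<lambda>z. h z - g z) < \<epsilon>"
      have "\<Phi> h - \<Phi> g = \<Phi> (\<lambda>z. h z - g z)" using lin[OF h g, of 1 "-1"] by simp
      moreover have "(\<lambda>z. h z - g z) \<in> Bernstein1 \<sigma>" using Bernstein1_lincomb[OF h g, of 1 "-1"] by simp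
      ultimately show "cmod (\<Phi> h - \<Phi> g) < \<epsilon>" using bd l by fastforce
    qed fact
  qed (rule lin)
  have "f w * cnj (sgn (f w)) = of_real (cmod (f w))" for w
    using complex_norm_square[of "f w"]
    by (cases "f w = 0") (simp_all add: sgn_div_norm power2_eq_square scaleR_conv_of_real field_simps)
  hence \<Phi>f: "\<Phi> f = 1" using assms(3) by (simp add: \<Phi>_def L1norm_def integral_complex_of_real)
  have fball: "f \<in> Bernstein1_ball \<sigma>" using f assms(3) by (simp add: Bernstein1_ball_def)
  have fn: "functional_norm \<sigma> \<Phi> = 1"
    unfolding functional_norm_def
  proof (rule cSup_eq_maximum)
    show "1 \<in> (\<lambda>g. cmod (\<Phi> g)) ` Bernstein1_ball \<sigma>" using fball \<Phi>f by (intro image_eqI[of _ _ f]) auto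
    fix x assume "x \<in> (\<lambda>g. cmod (\<Phi> g)) ` Bernstein1_ball \<sigma>"
    thus "x \<le> 1" using bd by (force simp: Bernstein1_ball_def)
  qed
  have "Re (\<Phi> g) < 1" if g: "g \<in> Bernstein1_ball \<sigma>" and ne: "g \<noteq> f" for g
  proof (rule ccontr)
    assume "\<not> Re (\<Phi> g) < 1"
    hence ge: "Re (\<Phi> g) \<ge> 1" by simp
    have gB: "g \<in> Bernstein1 \<sigma>" and g1: "L1norm g \<le> 1" using g by (auto simp: Bernstein1_ball_def)
    have "L1norm g \<le> Re (\<Phi> g)" using ge g1 by linarith
    hence quot: "g (of_real x) / f (of_real x) \<in> \<real>\<^sub>\<ge>\<^sub>0" if "f (of_real x) \<noteq> 0" for x :: real
      unfolding \<Phi>_def by (rule sgn_duality_equality[OF gB f _ that])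
    obtain c where c: "c \<ge> 0" "\<And>z. g z = of_real c * f z"
      using nonneg_quotient_constant[OF assms(1) f gB z0 assms(4-8) y0 \<delta> low quot] by blast
    \<comment> \<open>\<open>c\<close> is at once the norm of \<open>g\<close>, at most 1, and the
      value of the functional at \<open>g\<close>, at least 1.\<close>
    have "L1norm g = c" using assms(3) c by (simp add: L1norm_def norm_mult)
    moreover have "\<Phi> g = of_real c" using lin[OF f f, of "of_real c" 0] \<Phi>f by (simp add: c(2)[abs_def])
    ultimately have "c = 1" using ge g1 by simp
    thus False using ne c(2) by auto
  qed
  thus ?thesis
    unfolding exposed_point_def using fball clf \<Phi>f fn by blast
qed

end
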